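(* Let $n,m\ge 1$, let $\mathcal{X}\subset\mathbb{R}^n$ be nonempty, compact and convex, let $f_i:\mathbb{R}\to\mathbb{R}$ ($1\le i\le n$) be convex and $C^2$, and let $g=(g_1,\dots,g_m)^T:\mathbb{R}^n\to\mathbb{R}^m$ have convex $C^2$ components. Put $f(x)=\sum_{i=1}^n f_i(x_i)$ and $L(x,\mu)=f(x)+\mu^Tg(x)$. Assume that there is $\bar x\in\mathcal{X}$ with $g_j(\bar x)<0$ for all $j$, and that $L$ has a unique saddle point $(\hat x,\hat\mu)\in\mathcal{X}\times\mathbb{R}^m_+$, i.e. a unique point with $L(\hat x,\mu)\le L(\hat x,\hat\mu)\le L(x,\hat\mu)$ for all $x\in\mathcal{X}$, $\mu\in\mathbb{R}^m_+$. Let $\epsilon>0$, $\delta\in(0,1)$, $b=(b_1,\dots,b_n)$ with $b_i\ge 0$, and $B=\max_i b_i$. Let $K^i_{g'}$ be the Lipschitz constant of $\frac{\partial g}{\partial x_i}:\mathcal{X}\to\mathbb{R}^m$ and $K_g$ the Lipschitz constant of $g:\mathcal{X}\to\mathbb{R}^m$ (Euclidean norms). Let $\sigma_1,\dots,\sigma_n,\sigma_g$ be finite real constants with $$\sigma_i\ge\kappa(\delta,\epsilon)K^i_{g'}B\quad(1\le i\le n),\qquad \sigma_g\ge\kappa(\delta,\epsilon)K_gB,$$ and let $w_i(k)\sim\mathcal{N}(0,\sigma_i^2I_m)$ ($1\le i\le n$) and $w_g(k)\sim\mathcal{N}(0,\sigma_g^2I_m)$ be mutually independent over all indices and all times $k$.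 Then both of the following hold. (1) The mechanisms $(M^i_{g'}x)(k)=\frac{\partial g}{\partial x_i}(x(k))+w_i(k)$, for each $i\in\{1,\dots,n\}$, and $(M_gx)(k)=g(x(k))+w_g(k)$ are each $(\epsilon,\delta)$-differentially private with respect to the adjacency relation $\mathrm{Adj}_b$ on $\mathcal{X}$-valued signals. (2) Let $\bar\gamma,\bar\alpha>0$, $0<c_2<c_1$, $c_1+c_2<1$, $\gamma(k)=\bar\gamma k^{-c_1}$, $\alpha(k)=\bar\alpha k^{-c_2}$. From any deterministic initial point in $\mathcal{X}\times\mathbb{R}^m$, let $(x(k),\mu(k))_{k\ge1}$ be generated by $$x(k+1)=P_{\mathcal{X}}\Big[x(k)-\gamma(k)\big(\nabla f(x(k))+\partial_xG(x(k))^T\mu(k)+\alpha(k)x(k)\big)\Big],$$ $$\mu(k+1)=\Big[\mu(k)+\gamma(k)\big(g(x(k))+w_g(k)-\alpha(k)\mu(k)\big)\Big]_+,$$ where $\partial_xG(x(k))$ is the $m\times n$ matrix whose $i$-th column is $\frac{\partial g}{\partial x_i}(x(k))+w_i(k)$. Then $$\lim_{k\to\infty}\mathbb{E}\big(\|x(k)-\hat x\|_2^2\big)=0\quad\text{and}\quad\lim_{k\to\infty}\mathbb{E}\big(\|\mu(k)-\hat\mu\|_2^2\big)=0.$$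
   Context: $P_{\mathcal{X}}$ is Euclidean projection onto $\mathcal{X}$; $\mathbb{R}^m_+$ is the non-negative orthant and $[\cdot]_+$ is Euclidean projection onto it. The Lipschitz constant of a map is its smallest Lipschitz constant. $\mathcal{N}(0,\sigma^2I_m)$ with $\sigma=0$ is the point mass at $0$. $\mathcal{Q}(x)=\frac{1}{\sqrt{2\pi}}\int_x^\infty e^{-u^2/2}\,du$, $K_\delta=\mathcal{Q}^{-1}(\delta)$, and $\kappa(\delta,\epsilon)=\frac{1}{2\epsilon}\left(K_\delta+\sqrt{K_\delta^2+2\epsilon}\right)$. Input signals are (deterministic) sequences $x=(x(0),x(1),\dots)$ with $x(k)=(x_1(k),\dots,x_n(k))^T\in\mathcal{X}$; the $i$-th component signal is $x_i=(x_i(k))_{k\ge0}$. Adjacency: $\mathrm{Adj}_b(x,\tilde x)$ holds if and only if there is an index $i$ such that $\|x_i-\tilde x_i\|_2=\left(\sum_{k\ge0}|x_i(k)-\tilde x_i(k)|^2\right)^{1/2}\le b_i$ and $x_j=\tilde x_j$ for all $j\ne i$. A mechanism $M$ is a map sending each input signal $x$ to a random sequence $Mx$ in $\mathbb{R}^m$. Write $(Mx)_{0:k}=((Mx)(0)^T,\dots,(Mx)(k)^T)^T\in\mathbb{R}^{(k+1)m}$. $M$ is $(\epsilon,\delta)$-differentially private if for all input signals $x,\tilde x$ with $\mathrm{Adj}_b(x,\tilde x)$, $$\mathbb{P}\big((Mx)_{0:k}\in S\big)\le e^{\epsilon}\,\mathbb{P}\big((M\tilde x)_{0:k}\in S\big)+\delta\quad\text{for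 all }k\ge0\text{ and all Borel }S\subseteq\mathbb{R}^{(k+1)m}.$$ *)

theory Defs
  imports "HOL-Probability.Probability"
begin

subsection \<open>Calculus\<close>

definition C2 :: "('a::euclidean_space \<Rightarrow> 'b::real_normed_vector) \<Rightarrow> bool" where
  "C2 F \<longleftrightarrow> (\<exists>(F' :: 'a \<Rightarrow> 'a \<Rightarrow>\<^sub>L 'b) (F'' :: 'a \<Rightarrow> 'a \<Rightarrow>\<^sub>L ('a \<Rightarrow>\<^sub>L 'b)).
     (\<forall>x. (F has_derivative blinfun_apply (F' x)) (at x)) \<and>
     (\<forall>x. (F' has_derivative blinfun_apply (F'' x)) (at x)) \<and>
     continuous_on UNIV F'')"

definition partial_deriv ::
    "(real^'n \<Rightarrow> 'b::real_normed_vector) \<Rightarrow> 'n::finite \<Rightarrow> real^'n \<Rightarrow> 'b" where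
  "partial_deriv F i x = vector_derivative (\<lambda>t. F (x + t *\<^sub>R axis i 1)) (at 0)"

definition grad :: "(real^'n \<Rightarrow> real) \<Rightarrow> real^'n \<Rightarrow> real^('n::finite)" where
  "grad F x = (\<chi> i. partial_deriv F i x)"

text \<open>The infimum is over a set of reals, so it is meaningful only for maps that are Lipschitz
  on the set; it is then attained, that is, it is the smallest Lipschitz constant.
  \<open>C\<^sup>1\<close> maps on compact convex sets are Lipschitz.\<close>

definition lipschitz_const ::
    "'a::metric_space set \<Rightarrow> ('a \<Rightarrow> 'b::metric_space) \<Rightarrow> real" where
  "lipschitz_const S F = Inf {C. lipschitz_on C S F}"


subsection \<open>The constrained problem\<close>

definition nonneg_orthant :: "(real^('m::finite)) set" where
  "nonneg_orthant = {\<mu>. \<forall>j. 0 \<le> \<mu> $ j}"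

definition total_cost :: "('n \<Rightarrow> real \<Rightarrow> real) \<Rightarrow> real^('n::finite) \<Rightarrow> real" where
  "total_cost f x = (\<Sum>i\<in>UNIV. f i (x $ i))"

definition lagrangian ::
    "('n \<Rightarrow> real \<Rightarrow> real) \<Rightarrow> (real^'n \<Rightarrow> real^'m) \<Rightarrow> real^('n::finite) \<Rightarrow> real^('m::finite) \<Rightarrow> real"
  where "lagrangian f g x \<mu> = total_cost f x + \<mu> \<bullet> g x"

definition is_saddle_point ::
    "('a \<Rightarrow> 'b \<Rightarrow> real) \<Rightarrow> 'a set \<Rightarrow> 'b set \<Rightarrow> 'a \<Rightarrow> 'b \<Rightarrow> bool" where
  "is_saddle_point L X Y xh yh \<longleftrightarrow>
     xh \<in> X \<and> yh \<in> Y \<and> (\<forall>x\<in>X. \<forall>y\<in>Y. L xh y \<le> L xh yh \<and> L xh yh \<le> L x yh)"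


subsection \<open>Gaussian noise\<close>

definition gaussian_iso :: "real \<Rightarrow> (real^('m::finite)) measure" where
  "gaussian_iso \<sigma> =
     (if \<sigma> = 0 then return borel 0
      else density lborel (\<lambda>z. ennreal (\<Prod>j\<in>UNIV. normal_density 0 \<sigma> (z $ j))))"

definition Qfun :: "real \<Rightarrow> real" where
  "Qfun x = 1 / sqrt (2 * pi) * (LINT u:{x..}|lborel. exp (- (u\<^sup>2) / 2))"

text \<open>\<open>Qfun\<close> is a bijection from the reals onto the open unit interval; \<open>inv Qfun \<delta>\<close> is used
  only for \<open>\<delta>\<close> in that interval.\<close>

definition kappa :: "real \<Rightarrow> real \<Rightarrow> real" where
  "kappa \<delta> \<epsilon> = 1 / (2 * \<epsilon>) * (inv Qfun \<delta> + sqrt ((inv Qfun \<delta>)\<^sup>2 + 2 * \<epsilon>))"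

text \<open>All noise vectors as one family, in order to state mutual independence: index
  \<open>(Some i, k)\<close> stands for \<open>w\<^sub>i(k)\<close> and index \<open>(None, k)\<close> for \<open>w\<^sub>g(k)\<close>.\<close>

definition noise_family ::
    "('n \<Rightarrow> nat \<Rightarrow> 'w \<Rightarrow> 'v) \<Rightarrow> (nat \<Rightarrow> 'w \<Rightarrow> 'v) \<Rightarrow> 'n option \<times> nat \<Rightarrow> 'w \<Rightarrow> 'v" where
  "noise_family w wg = (\<lambda>(j, k). case j of None \<Rightarrow> wg k | Some i \<Rightarrow> w i k)"


subsection \<open>Differential privacy\<close>

definition input_signals :: "'a set \<Rightarrow> (nat \<Rightarrow> 'a) set" where
  "input_signals X = {x. \<forall>k. x k \<in> X}"

text \<open>Summability is required explicitly because a divergent \<open>suminf\<close> is an arbitrary real;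
  it expresses that the norm is finite.\<close>

definition adj ::
    "('n \<Rightarrow> real) \<Rightarrow> (nat \<Rightarrow> real^('n::finite)) \<Rightarrow> (nat \<Rightarrow> real^'n) \<Rightarrow> bool" where
  "adj b x y \<longleftrightarrow> (\<exists>i.
     summable (\<lambda>k. \<bar>x k $ i - y k $ i\<bar>\<^sup>2) \<and>
     sqrt (\<Sum>k. \<bar>x k $ i - y k $ i\<bar>\<^sup>2) \<le> b i \<and>
     (\<forall>j. j \<noteq> i \<longrightarrow> (\<forall>k. x k $ j = y k $ j)))"

text \<open>The first conjunct says that every \<open>M x\<close> is a random sequence. The initial segment
  \<open>(M x)\<^sub>0\<^sub>:\<^sub>k\<close> is a function on \<open>{..k}\<close>. Borel sets of the finite power of \<open>\<real>\<^sup>m\<close> are the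
  sets of the product \<open>\<sigma>\<close>-algebra, as \<open>\<real>\<^sup>m\<close> is second countable.\<close>

definition differentially_private ::
    "'w measure \<Rightarrow> (nat \<Rightarrow> 'a) set \<Rightarrow> ((nat \<Rightarrow> 'a) \<Rightarrow> (nat \<Rightarrow> 'a) \<Rightarrow> bool) \<Rightarrow> real \<Rightarrow> real \<Rightarrow>
     ((nat \<Rightarrow> 'a) \<Rightarrow> nat \<Rightarrow> 'w \<Rightarrow> real^('m::finite)) \<Rightarrow> bool" where
  "differentially_private P D R \<epsilon> \<delta> M \<longleftrightarrow>
     (\<forall>x\<in>D. \<forall>k. M x k \<in> borel_measurable P) \<and>
     (\<forall>x\<in>D. \<forall>y\<in>D. R x y \<longrightarrow>
       (\<forall>k. \<forall>S\<in>sets (Pi\<^sub>M {..k} (\<lambda>_. borel :: (real^'m) measure)).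
          measure P {\<omega>\<in>space P. (\<lambda>t\<in>{..k}. M x t \<omega>) \<in> S}
            \<le> exp \<epsilon> * measure P {\<omega>\<in>space P. (\<lambda>t\<in>{..k}. M y t \<omega>) \<in> S} + \<delta>))"

definition mech_grad ::
    "(real^'n \<Rightarrow> real^'m) \<Rightarrow> ('n \<Rightarrow> nat \<Rightarrow> 'w \<Rightarrow> real^'m) \<Rightarrow> 'n \<Rightarrow>
     (nat \<Rightarrow> real^'n) \<Rightarrow> nat \<Rightarrow> 'w \<Rightarrow> real^('m::finite)" where
  "mech_grad g w i x k \<omega> = partial_deriv g (i::'n::finite) (x k) + w i k \<omega>"

definition mech_g ::
    "(real^'n \<Rightarrow> real^'m) \<Rightarrow> (nat \<Rightarrow> 'w \<Rightarrow> real^'m) \<Rightarrow>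
     (nat \<Rightarrow> real^('n::finite)) \<Rightarrow> nat \<Rightarrow> 'w \<Rightarrow> real^('m::finite)" where
  "mech_g g wg x k \<omega> = g (x k) + wg k \<omega>"


subsection \<open>The private primal-dual iteration\<close>

definition noisy_jacobian ::
    "(real^'n \<Rightarrow> real^'m) \<Rightarrow> ('n \<Rightarrow> real^'m) \<Rightarrow> real^('n::finite) \<Rightarrow> real^'n^('m::finite)" where
  "noisy_jacobian g v x = (\<chi> j i. (partial_deriv g i x + v i) $ j)"

definition private_primal_dual ::
    "'w measure \<Rightarrow> (real^'n) set \<Rightarrow> ('n \<Rightarrow> real \<Rightarrow> real) \<Rightarrow> (real^'n \<Rightarrow> real^'m) \<Rightarrow>
     ('n \<Rightarrow> nat \<Rightarrow> 'w \<Rightarrow> real^'m) \<Rightarrow> (nat \<Rightarrow> 'w \<Rightarrow> real^'m) \<Rightarrow>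
     (nat \<Rightarrow> real) \<Rightarrow> (nat \<Rightarrow> real) \<Rightarrow> real^'n \<Rightarrow> real^'m \<Rightarrow>
     (nat \<Rightarrow> 'w \<Rightarrow> real^('n::finite)) \<Rightarrow> (nat \<Rightarrow> 'w \<Rightarrow> real^('m::finite)) \<Rightarrow> bool" where
  "private_primal_dual P X f g w wg \<gamma> \<alpha> x1 \<mu>1 x \<mu> \<longleftrightarrow>
     (\<forall>\<omega>\<in>space P.
        x 1 \<omega> = x1 \<and> \<mu> 1 \<omega> = \<mu>1 \<and>
        (\<forall>k\<ge>1.
           x (k + 1) \<omega> = closest_point X
             (x k \<omega> - \<gamma> k *\<^sub>R (grad (total_cost f) (x k \<omega>)
                + transpose (noisy_jacobian g (\<lambda>i. w i k \<omega>) (x k \<omega>)) *v \<mu> k \<omega>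
                + \<alpha> k *\<^sub>R x k \<omega>)) \<and>
           \<mu> (k + 1) \<omega> = closest_point nonneg_orthant
             (\<mu> k \<omega> + \<gamma> k *\<^sub>R (g (x k \<omega>) + wg k \<omega> - \<alpha> k *\<^sub>R \<mu> k \<omega>))))"

end

theory Submission
  imports Defs
begin

text \<open>
  Privacy. Adjacent signals shift the mean of the noise sequence by a vector of length at most
  \<open>r = K * B\<close>, where \<open>K\<close> is the Lipschitz constant of the released map. For Gaussian noise of
  standard deviation \<open>\<sigma>\<close> the logarithm of the likelihood ratio of two laws that differ by a shift of
  length \<open>r\<close> is again Gaussian, with mean \<open>r\<^sup>2 / (2 * \<sigma>\<^sup>2)\<close> and standard deviation \<open>r / \<sigma>\<close>. With
  \<open>s = \<sigma> / r\<close> it exceeds \<open>\<epsilon>\<close> with probability \<open>Qfun (\<epsilon> * s - 1 / (2 * s))\<close>, and \<open>kappa \<delta> \<epsilon>\<close> is the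
  value of \<open>s\<close> for which this probability is \<open>\<delta>\<close> (\<open>gaussian_mechanism\<close>,
  \<open>gaussian_differentially_private\<close>).

  Convergence. The saddle points are the solutions of a variational inequality on the product of \<open>X\<close>
  and the nonnegative orthant for the operator \<open>F\<close> with components \<open>\<nabla>\<^sub>x L\<close> and \<open>- g\<close>, which is monotone
  because the Lagrangian is convex in \<open>x\<close> and affine in the multiplier. The operator \<open>F z + \<alpha> z\<close> is
  strongly monotone; its solution \<open>z\<^sub>\<alpha>\<close> exists by Brouwer's theorem, is no longer than the saddle
  point, is locally Lipschitz in \<open>\<alpha>\<close>, and tends to the saddle point for \<open>\<alpha> \<rightarrow> 0\<close> because this is the
  only possible limit (locale \<open>monotone_vi\<close>). The iteration tracks the moving target \<open>z\<^sub>\<alpha>\<close> with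
  \<open>\<alpha> = \<alpha>(k)\<close>: the state is independent of the current noise, so one step changes the mean square
  distance \<open>e\<close> to the target to at most \<open>(1 - 2 \<gamma> \<alpha> + C \<gamma>\<^sup>2) e + C \<gamma>\<^sup>2\<close> (\<open>one_step\<close>). The term
  \<open>C \<gamma>\<^sup>2 e\<close> accounts for the noise on the Jacobian, whose effect is proportional to the unbounded
  multiplier; it is dominated by \<open>\<gamma> \<alpha> e\<close> since \<open>\<gamma> / \<alpha>\<close> tends to \<open>0\<close>, that is, since \<open>c2 < c1\<close>. The motion
  of the target in one step is of order \<open>1 / k\<close>. Altogether \<open>e\<close> satisfies a recursion with
  contraction rate \<open>\<gamma> \<alpha> / 2\<close> and with a disturbance that, relative to this rate, is of order
  \<open>\<gamma> / \<alpha> + 1 / (k \<gamma> \<alpha>)\<^sup>2\<close>. Since \<open>c1 + c2 < 1\<close>, the disturbance tends to \<open>0\<close> and the rates have a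
  divergent sum, so \<open>e\<close> tends to \<open>0\<close> (\<open>recursive_inequality_tendsto_0\<close>, \<open>err_tendsto_0\<close>).
\<close>

section \<open>Tikhonov regularization of monotone variational inequalities\<close>

text \<open>A fixed point of \<open>\<lambda>z. closest_point S (z - A z)\<close>, which Brouwer's theorem provides, is a solution:
  the obtuse angle property of the projection at \<open>z - A z\<close> is the variational inequality.\<close>

lemma variational_inequality_ex:
  fixes A :: "'a::euclidean_space \<Rightarrow> 'a"
  assumes S: "compact S" "convex S" "S \<noteq> {}" and A: "continuous_on S A"
  shows "\<exists>z\<in>S. \<forall>u\<in>S. 0 \<le> A z \<bullet> (u - z)"
proof -
  have "closed S" using S by (simp add: compact_imp_closed)
  have "continuous_on S (\<lambda>z. closest_point S (z - A z))"
    using continuous_on_compose[OF continuous_on_diff[OF continuous_on_id A]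
        continuous_on_closest_point[OF S(2) \<open>closed S\<close> S(3)]]
    by (simp add: o_def)
  moreover have "(\<lambda>z. closest_point S (z - A z)) \<in> S \<rightarrow> S"
    using closest_point_in_set[OF \<open>closed S\<close> S(3)] by auto
  ultimately obtain z where z: "z \<in> S" "closest_point S (z - A z) = z"
    by (rule brouwer[OF S])
  have "0 \<le> A z \<bullet> (u - z)" if "u \<in> S" for u
    using closest_point_dot[OF S(2) \<open>closed S\<close> that, of "z - A z"] z(2) by simp
  with z(1) show ?thesis by blast
qed

text \<open>The hypothesis \<open>minty\<close> evaluates \<open>A\<close> at \<open>z\<close> and not at \<open>zh\<close>. In this weak form it follows from the
  two saddle point inequalities alone, without a first-order condition at the saddle point.\<close>

locale monotone_vi =
  fixes S :: "'a::euclidean_space set" and A :: "'a \<Rightarrow> 'a" and zh :: 'a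
  assumes closed: "closed S" and convex: "convex S" and cont: "continuous_on S A"
    and mono: "\<And>u v. u \<in> S \<Longrightarrow> v \<in> S \<Longrightarrow> 0 \<le> (A u - A v) \<bullet> (u - v)"
    and zh: "zh \<in> S" and minty: "\<And>z. z \<in> S \<Longrightarrow> 0 \<le> A z \<bullet> (z - zh)"
    and unique: "\<And>z. z \<in> S \<Longrightarrow> (\<And>u. u \<in> S \<Longrightarrow> 0 \<le> A z \<bullet> (u - z)) \<Longrightarrow> z = zh"
begin

text \<open>Tested at \<open>zh\<close>, the part of the inequality that comes from \<open>A\<close> has the wrong sign by \<open>minty\<close>, so
  the regularizing term alone gives \<open>0 \<le> z \<bullet> (zh - z)\<close>.\<close>

lemma regularized_norm_le:
  assumes "\<alpha> > 0" "z \<in> S" and vi: "0 \<le> (A z + \<alpha> *\<^sub>R z) \<bullet> (zh - z)"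
  shows "norm z \<le> norm zh"
proof -
  have "0 \<le> \<alpha> * (z \<bullet> (zh - z))"
    using vi minty[OF \<open>z \<in> S\<close>] by (simp add: inner_simps algebra_simps)
  then have "z \<bullet> z \<le> z \<bullet> zh"
    using \<open>\<alpha> > 0\<close> by (simp add: zero_le_mult_iff inner_simps)
  also have "\<dots> \<le> norm z * norm zh" by (rule norm_cauchy_schwarz)
  finally have "norm z * norm z \<le> norm z * norm zh"
    by (simp add: power2_norm_eq_inner flip: power2_eq_square)
  then show ?thesis by (cases "z = 0") auto
qed

text \<open>The set \<open>S\<close> may be unbounded. The inequality is solved on a truncation of \<open>S\<close> by a ball that is
  larger than the a priori bound for its solutions.\<close>

lemma regularized_ex:
  assumes "\<alpha> > 0"
  shows "\<exists>z\<in>S. \<forall>u\<in>S. 0 \<le> (A z + \<alpha> *\<^sub>R z) \<bullet> (u - z)"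
proof -
  define T where "T = S \<inter> cball 0 (norm zh + 1)"
  have "zh \<in> T" using zh by (simp add: T_def)
  moreover have "compact T" "convex T"
    using closed convex by (auto simp: T_def closed_Int_compact intro: convex_Int)
  moreover have "continuous_on T (\<lambda>z. A z + \<alpha> *\<^sub>R z)"
    by (intro continuous_intros continuous_on_subset[OF cont]) (auto simp: T_def)
  ultimately obtain z where z: "z \<in> T" "\<And>u. u \<in> T \<Longrightarrow> 0 \<le> (A z + \<alpha> *\<^sub>R z) \<bullet> (u - z)"
    using variational_inequality_ex[of T "\<lambda>z. A z + \<alpha> *\<^sub>R z"] by (metis empty_iff)
  have "z \<in> S" using z(1) by (simp add: T_def)
  have nz: "norm z \<le> norm zh"
    using regularized_norm_le[OF assms \<open>z \<in> S\<close> z(2)[OF \<open>zh \<in> T\<close>]] .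
  have "0 \<le> (A z + \<alpha> *\<^sub>R z) \<bullet> (u - z)" if "u \<in> S" for u
  proof -
    \<comment> \<open>The truncation is not active at \<open>z\<close>, so a short step towards \<open>u\<close> stays inside it.\<close>
    define t where "t = 1 / (1 + norm (u - z))"
    have t: "0 < t" "t \<le> 1" "t * norm (u - z) \<le> 1"
      by (auto simp: t_def add_pos_nonneg field_simps)
    have "z + t *\<^sub>R (u - z) = (1 - t) *\<^sub>R z + t *\<^sub>R u" by (simp add: algebra_simps)
    then have "z + t *\<^sub>R (u - z) \<in> S"
      using convexD[OF convex \<open>z \<in> S\<close> \<open>u \<in> S\<close>, of "1 - t" t] t by simp
    moreover have "norm (z + t *\<^sub>R (u - z)) \<le> norm zh + 1"
      using norm_triangle_ineq[of z "t *\<^sub>R (u - z)"] nz t by simp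
    ultimately have "0 \<le> (A z + \<alpha> *\<^sub>R z) \<bullet> (t *\<^sub>R (u - z))"
      using z(2)[of "z + t *\<^sub>R (u - z)"] by (simp add: T_def)
    then show ?thesis using t(1) by (simp add: zero_le_mult_iff)
  qed
  then show ?thesis by (intro bexI[OF _ \<open>z \<in> S\<close>] ballI)
qed

text \<open>The Tikhonov path. For \<open>\<alpha> > 0\<close> the chosen point is the only solution, by strong monotonicity.\<close>

definition tik :: "real \<Rightarrow> 'a" where
  "tik \<alpha> = (SOME z. z \<in> S \<and> (\<forall>u\<in>S. 0 \<le> (A z + \<alpha> *\<^sub>R z) \<bullet> (u - z)))"

lemma
  assumes "\<alpha> > 0"
  shows tik_in: "tik \<alpha> \<in> S"
    and tik_vi: "u \<in> S \<Longrightarrow> 0 \<le> (A (tik \<alpha>) + \<alpha> *\<^sub>R tik \<alpha>) \<bullet> (u - tik \<alpha>)"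
proof -
  have "tik \<alpha> \<in> S \<and> (\<forall>u\<in>S. 0 \<le> (A (tik \<alpha>) + \<alpha> *\<^sub>R tik \<alpha>) \<bullet> (u - tik \<alpha>))"
    unfolding tik_def by (rule someI_ex) (use regularized_ex[OF assms] in auto)
  then show "tik \<alpha> \<in> S"
    and "u \<in> S \<Longrightarrow> 0 \<le> (A (tik \<alpha>) + \<alpha> *\<^sub>R tik \<alpha>) \<bullet> (u - tik \<alpha>)"
    by (rule conjunct1, rule bspec[OF conjunct2])
qed

lemma norm_tik_le: "\<alpha> > 0 \<Longrightarrow> norm (tik \<alpha>) \<le> norm zh"
  by (rule regularized_norm_le[OF _ tik_in tik_vi[OF _ zh]])

lemma tik_strongly_monotone:
  assumes "\<alpha> > 0" "z \<in> S"
  shows "\<alpha> * (norm (z - tik \<alpha>))\<^sup>2 \<le> (A z + \<alpha> *\<^sub>R z) \<bullet> (z - tik \<alpha>)"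
proof -
  have "(A z + \<alpha> *\<^sub>R z) \<bullet> (z - t)
      = (A z - A t) \<bullet> (z - t) + (A t + \<alpha> *\<^sub>R t) \<bullet> (z - t) + \<alpha> * ((z - t) \<bullet> (z - t))" for t
    by (simp add: inner_add_left inner_diff_left algebra_simps)
  from this[of "tik \<alpha>"] show ?thesis
    using tik_vi[OF assms] mono[OF assms(2) tik_in[OF assms(1)]]
    by (simp add: power2_norm_eq_inner)
qed

text \<open>Each of the two inequalities is tested at the solution of the other one, and the results are
  added; monotonicity leaves only the regularizing terms.\<close>

lemma tik_lipschitz:
  assumes "\<alpha> > 0" "\<beta> > 0"
  shows "\<alpha> * norm (tik \<alpha> - tik \<beta>) \<le> \<bar>\<alpha> - \<beta>\<bar> * norm zh"
proof -
  define d where "d = tik \<alpha> - tik \<beta>"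
  have "\<alpha> * (norm d)\<^sup>2 \<le> (\<beta> - \<alpha>) * (tik \<beta> \<bullet> d)"
  proof -
    have "(A s - A t) \<bullet> (s - t) + \<alpha> * ((s - t) \<bullet> (s - t))
        + (A s + \<alpha> *\<^sub>R s) \<bullet> (t - s) + (A t + \<beta> *\<^sub>R t) \<bullet> (s - t) = (\<beta> - \<alpha>) * (t \<bullet> (s - t))" for s t
      by (simp add: inner_add_left inner_diff_left inner_diff_right algebra_simps)
    from this[of "tik \<alpha>" "tik \<beta>"] show ?thesis
      using tik_vi[OF assms(1) tik_in[OF assms(2)]] tik_vi[OF assms(2) tik_in[OF assms(1)]]
        mono[OF tik_in[OF assms(1)] tik_in[OF assms(2)]]
      unfolding d_def power2_norm_eq_inner by linarith
  qed
  also have "\<dots> \<le> \<bar>\<alpha> - \<beta>\<bar> * (norm zh * norm d)"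
  proof -
    have "\<bar>tik \<beta> \<bullet> d\<bar> \<le> norm zh * norm d"
      using Cauchy_Schwarz_ineq2[of "tik \<beta>" d] norm_tik_le[OF assms(2)]
      by (meson mult_right_mono norm_ge_zero order_trans)
    then have "\<bar>(\<beta> - \<alpha>) * (tik \<beta> \<bullet> d)\<bar> \<le> \<bar>\<alpha> - \<beta>\<bar> * (norm zh * norm d)"
      unfolding abs_mult by (intro mult_mono) auto
    then show ?thesis by linarith
  qed
  finally have "norm d * (\<alpha> * norm d) \<le> norm d * (\<bar>\<alpha> - \<beta>\<bar> * norm zh)"
    by (simp add: power2_eq_square mult_ac)
  then show ?thesis unfolding d_def[symmetric] by (cases "d = 0") auto
qed

text \<open>The path is bounded, and the limit of the regularized inequalities along a convergent subsequence
  is the inequality whose only solution is \<open>zh\<close>.\<close>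

lemma tik_tendsto:
  assumes pos: "\<And>k. \<alpha> k > 0" and lim: "\<alpha> \<longlonglongrightarrow> 0"
  shows "(\<lambda>k. tik (\<alpha> k)) \<longlonglongrightarrow> zh"
proof (rule ccontr)
  define T where "T = S \<inter> cball 0 (norm zh)"
  assume "\<not> (\<lambda>k. tik (\<alpha> k)) \<longlonglongrightarrow> zh"
  then obtain e where "e > 0" and e: "\<And>N. \<exists>k\<ge>N. e \<le> dist (tik (\<alpha> k)) zh"
    by (auto simp: lim_sequentially not_less)
  then have "infinite {k. e \<le> dist (tik (\<alpha> k)) zh}"
    by (simp add: infinite_nat_iff_unbounded_le)
  then obtain r :: "nat \<Rightarrow> nat" where r: "strict_mono r" "\<And>k. e \<le> dist (tik (\<alpha> (r k))) zh"
    using infinite_enumerate by blast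
  have "compact T" using closed by (auto simp: T_def closed_Int_compact)
  moreover have "\<forall>k. (tik \<circ> \<alpha> \<circ> r) k \<in> T"
    using tik_in norm_tik_le pos by (simp add: T_def)
  ultimately obtain l q where l: "l \<in> T" "strict_mono q" "(tik \<circ> \<alpha> \<circ> r \<circ> q) \<longlonglongrightarrow> l"
    unfolding compact_def by metis
  have lS: "l \<in> S" using l(1) by (simp add: T_def)
  define z where "z = tik \<circ> \<alpha> \<circ> r \<circ> q"
  define a where "a = \<alpha> \<circ> r \<circ> q"
  have za: "z k = tik (a k)" "a k > 0" for k by (auto simp: z_def a_def pos)
  have zl: "z \<longlonglongrightarrow> l" using l(3) by (simp add: z_def)
  have al: "a \<longlonglongrightarrow> 0"
    using LIMSEQ_subseq_LIMSEQ[OF LIMSEQ_subseq_LIMSEQ[OF lim r(1)] l(2)] by (simp add: a_def)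
  have Al: "(\<lambda>k. A (z k)) \<longlonglongrightarrow> A l"
    by (rule continuous_on_tendsto_compose[OF cont zl lS]) (simp add: za tik_in)
  have "0 \<le> A l \<bullet> (u - l)" if "u \<in> S" for u
  proof (rule LIMSEQ_le_const)
    have "(\<lambda>k. (A (z k) + a k *\<^sub>R z k) \<bullet> (u - z k)) \<longlonglongrightarrow> (A l + 0 *\<^sub>R l) \<bullet> (u - l)"
      by (intro tendsto_intros Al al zl)
    then show "(\<lambda>k. (A (z k) + a k *\<^sub>R z k) \<bullet> (u - z k)) \<longlonglongrightarrow> A l \<bullet> (u - l)" by simp
    show "\<exists>N. \<forall>k\<ge>N. 0 \<le> (A (z k) + a k *\<^sub>R z k) \<bullet> (u - z k)"
      using tik_vi that za by auto
  qed
  then have "l = zh" using unique lS by blast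
  moreover have "e \<le> dist l zh"
  proof (rule LIMSEQ_le_const)
    show "(\<lambda>k. dist (z k) zh) \<longlonglongrightarrow> dist l zh" by (intro tendsto_intros zl)
    show "\<exists>N. \<forall>k\<ge>N. e \<le> dist (z k) zh" using r(2) by (auto simp: z_def)
  qed
  ultimately show False using \<open>e > 0\<close> by simp
qed

end

section \<open>A recursive inequality\<close>

text \<open>Once \<open>\<beta> k < \<eta> / 2\<close>, the excess of \<open>e k\<close> over \<open>\<eta> / 2\<close> is multiplied in each step by at most
  \<open>1 - a k \<le> exp (- a k)\<close>, and the product of these factors tends to \<open>0\<close>.\<close>

lemma recursive_inequality_tendsto_0:
  fixes e a \<beta> :: "nat \<Rightarrow> real"
  assumes e: "\<And>k. 0 \<le> e k"
    and rec: "eventually (\<lambda>k. e (Suc k) \<le> (1 - a k) * e k + a k * \<beta> k) sequentially"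
    and a: "eventually (\<lambda>k. 0 \<le> a k \<and> a k \<le> 1) sequentially"
    and div: "filterlim (\<lambda>n. \<Sum>k<n. a k) at_top sequentially"
    and \<beta>: "\<beta> \<longlonglongrightarrow> 0"
  shows "e \<longlonglongrightarrow> 0"
proof -
  have upper: "eventually (\<lambda>k. e k < \<eta>) sequentially" if "\<eta> > 0" for \<eta>
  proof -
    define d where "d = (\<lambda>k. max 0 (e k - \<eta> / 2))"
    have "eventually (\<lambda>k. \<beta> k < \<eta> / 2) sequentially"
      by (rule order_tendstoD(2)[OF \<beta>]) (use \<open>\<eta> > 0\<close> in simp)
    with rec a have "eventually (\<lambda>k. d (Suc k) \<le> (1 - a k) * d k \<and> 0 \<le> a k \<and> a k \<le> 1) sequentially"
    proof eventually_elim
      case (elim k)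
      have "a k * \<beta> k \<le> a k * (\<eta> / 2)" using elim by (intro mult_left_mono) auto
      moreover have distrib: "(1 - a k) * (e k - h) = (1 - a k) * e k + a k * h - h" for h
        by (simp add: algebra_simps)
      ultimately have "e (Suc k) - \<eta> / 2 \<le> (1 - a k) * (e k - \<eta> / 2)"
        using elim unfolding distrib by linarith
      also have "\<dots> \<le> (1 - a k) * d k"
        using elim by (intro mult_left_mono) (auto simp: d_def)
      finally show ?case using elim by (simp add: d_def)
    qed
    then obtain N where N: "\<And>k. k \<ge> N \<Longrightarrow> d (Suc k) \<le> (1 - a k) * d k \<and> 0 \<le> a k \<and> a k \<le> 1"
      by (auto simp: eventually_sequentially)
    have dec: "d n \<le> d N * exp (- (\<Sum>k=N..<n. a k))" if "n \<ge> N" for n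
      using that
    proof (induction n rule: dec_induct)
      case (step n)
      have "d (Suc n) \<le> (1 - a n) * d n" using N step by simp
      also have "\<dots> \<le> exp (- a n) * (d N * exp (- (\<Sum>k=N..<n. a k)))"
        using step N[of n] exp_ge_add_one_self[of "- a n"] by (intro mult_mono) (auto simp: d_def)
      also have "\<dots> = d N * exp (- (\<Sum>k=N..<Suc n. a k))"
        using step by (simp add: exp_add[symmetric] mult.left_commute)
      finally show ?case .
    qed simp
    have "filterlim (\<lambda>n. - (\<Sum>k<N. a k) + (\<Sum>k<n. a k)) at_top sequentially"
      by (intro filterlim_tendsto_add_at_top[OF tendsto_const div])
    moreover have "eventually (\<lambda>n. - (\<Sum>k<N. a k) + (\<Sum>k<n. a k) = (\<Sum>k=N..<n. a k)) sequentially"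
      using eventually_ge_at_top[of N]
    proof eventually_elim
      case (elim n)
      show ?case using sum.atLeastLessThan_concat[of 0 N n a] elim
        by (simp add: lessThan_atLeast0)
    qed
    ultimately have "filterlim (\<lambda>n. \<Sum>k=N..<n. a k) at_top sequentially"
      by (simp add: filterlim_cong)
    then have "(\<lambda>n. d N * exp (- (\<Sum>k=N..<n. a k))) \<longlonglongrightarrow> d N * 0"
      by (intro tendsto_intros filterlim_compose[OF exp_at_bot] filterlim_uminus_at_bot_at_top[THEN filterlim_compose])
    then have "eventually (\<lambda>n. d N * exp (- (\<Sum>k=N..<n. a k)) < \<eta> / 2) sequentially"
      using order_tendstoD(2) \<open>\<eta> > 0\<close> by (metis half_gt_zero mult_zero_right)
    with eventually_ge_at_top[of N] show ?thesis
    proof eventually_elim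
      case (elim n)
      show ?case using dec[OF elim(1)] elim(2) by (simp add: d_def split: if_splits)
    qed
  qed
  show ?thesis
    by (rule order_tendstoI) (use e upper in \<open>auto intro: less_le_trans simp: eventually_sequentially\<close>)
qed

section \<open>Isotropic Gaussian vectors\<close>

lemma density_PiM:
  fixes M :: "'i \<Rightarrow> 'a measure"
  assumes I: "finite I" and M: "\<And>i. sigma_finite_measure (M i)"
    and f [measurable]: "\<And>i. f i \<in> borel_measurable (M i)"
    and D: "\<And>i. sigma_finite_measure (density (M i) (f i))"
  shows "density (PiM I M) (\<lambda>x. \<Prod>i\<in>I. f i (x i)) = PiM I (\<lambda>i. density (M i) (f i))"
proof -
  interpret M: product_sigma_finite M using M by (simp add: product_sigma_finite_def)
  interpret D: product_sigma_finite "\<lambda>i. density (M i) (f i)"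
    using D by (simp add: product_sigma_finite_def)
  show ?thesis
  proof (rule D.PiM_eqI[OF I])
    show "sets (density (PiM I M) (\<lambda>x. \<Prod>i\<in>I. f i (x i))) = sets (PiM I (\<lambda>i. density (M i) (f i)))"
      by (simp cong: sets_PiM_cong)
    fix A assume "\<And>i. i \<in> I \<Longrightarrow> A i \<in> sets (density (M i) (f i))"
    then have A [measurable]: "\<And>i. i \<in> I \<Longrightarrow> A i \<in> sets (M i)" by simp
    have "emeasure (density (PiM I M) (\<lambda>x. \<Prod>i\<in>I. f i (x i))) (Pi\<^sub>E I A)
        = (\<integral>\<^sup>+x. (\<Prod>i\<in>I. f i (x i)) * indicator (Pi\<^sub>E I A) x \<partial>PiM I M)"
      by (rule emeasure_density) (auto intro!: sets_PiM_I_finite I A)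
    also have "\<dots> = (\<integral>\<^sup>+x. (\<Prod>i\<in>I. f i (x i) * indicator (A i) (x i)) \<partial>PiM I M)"
    proof (rule nn_integral_cong)
      fix x assume x: "x \<in> space (PiM I M)"
      have "indicator (Pi\<^sub>E I A) x = (\<Prod>i\<in>I. indicator (A i) (x i) :: ennreal)"
        using x I by (auto simp: space_PiM indicator_def PiE_iff prod_zero_iff)
      then show "(\<Prod>i\<in>I. f i (x i)) * indicator (Pi\<^sub>E I A) x = (\<Prod>i\<in>I. f i (x i) * indicator (A i) (x i))"
        by (simp add: prod.distrib)
    qed
    also have "\<dots> = (\<Prod>i\<in>I. \<integral>\<^sup>+x. f i x * indicator (A i) x \<partial>M i)"
      by (rule M.product_nn_integral_prod) (auto intro: I A)
    also have "\<dots> = (\<Prod>i\<in>I. emeasure (density (M i) (f i)) (A i))"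
      by (intro prod.cong refl) (simp add: emeasure_density)
    finally show "emeasure (density (PiM I M) (\<lambda>x. \<Prod>i\<in>I. f i (x i))) (Pi\<^sub>E I A)
        = (\<Prod>i\<in>I. emeasure (density (M i) (f i)) (A i))" .
  qed
qed

lemma borel_measurable_vec_lambda [measurable]:
  fixes F :: "'a \<Rightarrow> 'm::finite \<Rightarrow> real"
  assumes "\<And>j. (\<lambda>x. F x j) \<in> borel_measurable M"
  shows "(\<lambda>x. \<chi> j. F x j) \<in> borel_measurable M"
proof (subst borel_measurable_euclidean_space, rule ballI)
  fix b :: "real^'m" assume "b \<in> Basis"
  then obtain j where "b = axis j 1" by (auto simp: Basis_vec_def)
  then have "(\<lambda>x. (\<chi> j. F x j) \<bullet> b) = (\<lambda>x. F x j)" by (simp add: inner_axis)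
  then show "(\<lambda>x. (\<chi> j. F x j) \<bullet> b) \<in> borel_measurable M" using assms by simp
qed

lemma lborel_vec_eq_distr:
  "(lborel :: (real^'m::finite) measure) = distr (PiM UNIV (\<lambda>_. lborel)) borel (\<lambda>f. \<chi> j. f j)"
proof (rule lborel_eqI)
  interpret product_sigma_finite "\<lambda>_::'m. lborel :: real measure"
    by (simp add: product_sigma_finite_def sigma_finite_lborel)
  have [measurable]: "(\<lambda>f. \<chi> j. f j) \<in> PiM UNIV (\<lambda>_. lborel :: real measure) \<rightarrow>\<^sub>M (borel :: (real^'m) measure)"
    by (rule borel_measurable_vec_lambda) simp
  fix l u :: "real^'m" assume le: "\<And>b. b \<in> Basis \<Longrightarrow> l \<bullet> b \<le> u \<bullet> b"
  have le': "l $ j \<le> u $ j" for j using le[of "axis j 1"] by (simp add: inner_axis)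
  have "(\<lambda>f. \<chi> j. f j) -` box l u \<inter> space (PiM UNIV (\<lambda>_. lborel)) = Pi\<^sub>E UNIV (\<lambda>j. {l $ j<..<u $ j})"
    by (auto simp: space_PiM mem_box_cart PiE_iff)
  then have "emeasure (distr (PiM UNIV (\<lambda>_. lborel)) borel (\<lambda>f. \<chi> j. f j)) (box l u)
      = (\<Prod>j\<in>UNIV. emeasure lborel {l $ j<..<u $ j})"
    by (simp add: emeasure_distr emeasure_PiM)
  also have "\<dots> = ennreal (\<Prod>j\<in>UNIV. u $ j - l $ j)"
    using le' by (simp add: prod_ennreal)
  also have "(\<Prod>j\<in>UNIV. u $ j - l $ j) = (\<Prod>b\<in>Basis. (u - l) \<bullet> b)"
    by (simp add: Basis_vec_def UNION_singleton_eq_range prod.reindex inj_on_def axis_eq_axis inner_axis)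
  finally show "emeasure (distr (PiM UNIV (\<lambda>_. lborel)) borel (\<lambda>f. \<chi> j. f j)) (box l u)
      = (\<Prod>b\<in>Basis. (u - l) \<bullet> b)" .
qed simp

definition iso_density :: "real \<Rightarrow> real^'m::finite \<Rightarrow> real" where
  "iso_density \<sigma> z = (\<Prod>j\<in>UNIV. normal_density 0 \<sigma> (z $ j))"

lemma iso_density_eq:
  "iso_density \<sigma> (z :: real^'m::finite)
    = (1 / sqrt (2 * pi * \<sigma>\<^sup>2)) ^ CARD('m) * exp (- (norm z)\<^sup>2 / (2 * \<sigma>\<^sup>2))"
  by (simp add: iso_density_def normal_density_def prod.distrib prod_dividef exp_sum[symmetric] norm_vec_def
      L2_set_def sum_nonneg sum_negf sum_divide_distrib power_divide)

lemma iso_density_pos: "0 < \<sigma> \<Longrightarrow> 0 < iso_density \<sigma> z"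
  by (simp add: iso_density_def prod_pos normal_density_pos)

lemma borel_measurable_iso_density [measurable]: "iso_density \<sigma> \<in> borel_measurable borel"
  unfolding iso_density_eq[abs_def] by measurable

lemma gaussian_iso_eq_density:
  "0 < \<sigma> \<Longrightarrow> gaussian_iso \<sigma> = density lborel (\<lambda>z. ennreal (iso_density \<sigma> z))"
  by (simp add: gaussian_iso_def iso_density_def)

text \<open>The coordinates of an isotropic Gaussian vector are independent: as a product measure its law
  is open to the theory of sums of independent normal variables.\<close>

lemma gaussian_iso_eq_distr:
  assumes \<sigma>: "0 < \<sigma>"
  shows "(gaussian_iso \<sigma> :: (real^'m::finite) measure)
    = distr (PiM UNIV (\<lambda>_. density lborel (normal_density 0 \<sigma>))) borel (\<lambda>f. \<chi> j. f j)"
proof -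
  have [measurable]: "(\<lambda>f. \<chi> j. f j) \<in> PiM UNIV (\<lambda>_. lborel :: real measure) \<rightarrow>\<^sub>M (borel :: (real^'m) measure)"
    by (rule borel_measurable_vec_lambda) simp
  have "gaussian_iso \<sigma> = density (distr (PiM UNIV (\<lambda>_. lborel)) borel (\<lambda>f. \<chi> j. f j))
      (\<lambda>z::real^'m. ennreal (iso_density \<sigma> z))"
    by (simp add: gaussian_iso_eq_density[OF \<sigma>] flip: lborel_vec_eq_distr)
  also have "\<dots> = distr (density (PiM UNIV (\<lambda>_. lborel)) (\<lambda>f. \<Prod>j\<in>UNIV. ennreal (normal_density 0 \<sigma> (f j))))
      borel (\<lambda>f. \<chi> j. f j)"
    by (subst density_distr) (simp_all add: iso_density_def prod_ennreal)
  also have "density (PiM (UNIV::'m set) (\<lambda>_. lborel)) (\<lambda>f. \<Prod>j\<in>UNIV. ennreal (normal_density 0 \<sigma> (f j)))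
      = PiM UNIV (\<lambda>_. density lborel (normal_density 0 \<sigma>))"
    using \<sigma> by (intro density_PiM)
      (auto intro: sigma_finite_lborel prob_space_imp_sigma_finite prob_space_normal_density)
  finally show ?thesis .
qed

text \<open>A variance \<open>0\<close> is admitted for identically vanishing summands, so that the
  lemma applies to linear forms with some coefficients equal to zero.\<close>

lemma (in prob_space) sum_indep_normal_degenerate:
  assumes I: "finite I" "indep_vars (\<lambda>_. borel) X I"
    and X: "\<And>i. i \<in> I \<Longrightarrow> s i > 0 \<Longrightarrow> distributed M lborel (X i) (normal_density 0 (s i))"
      "\<And>i. i \<in> I \<Longrightarrow> s i \<noteq> 0 \<Longrightarrow> s i > 0"
      "\<And>i \<omega>. i \<in> I \<Longrightarrow> s i = 0 \<Longrightarrow> X i \<omega> = 0"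
    and pos: "(\<Sum>i\<in>I. (s i)\<^sup>2) \<noteq> 0"
  shows "distributed M lborel (\<lambda>\<omega>. \<Sum>i\<in>I. X i \<omega>) (normal_density 0 (sqrt (\<Sum>i\<in>I. (s i)\<^sup>2)))"
proof -
  define J where "J = {i\<in>I. s i \<noteq> 0}"
  have J: "finite J" "J \<subseteq> I" "J \<noteq> {}"
    using I pos by (auto simp: J_def intro: sum.neutral)
  have "distributed M lborel (\<lambda>\<omega>. \<Sum>i\<in>J. X i \<omega>) (normal_density (\<Sum>i\<in>J. 0) (sqrt (\<Sum>i\<in>J. (s i)\<^sup>2)))"
    by (rule sum_indep_normal) (use J X in \<open>auto simp: J_def intro: indep_vars_subset[OF I(2)]\<close>)
  moreover have "(\<Sum>i\<in>J. X i \<omega>) = (\<Sum>i\<in>I. X i \<omega>)" for \<omega>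
    using I X by (intro sum.mono_neutral_left) (auto simp: J_def)
  moreover have "(\<Sum>i\<in>J. (s i)\<^sup>2) = (\<Sum>i\<in>I. (s i)\<^sup>2)"
    using I by (intro sum.mono_neutral_left) (auto simp: J_def)
  ultimately show ?thesis by simp
qed

lemma (in prob_space) gaussian_iso_coordinates:
  fixes W :: "'a \<Rightarrow> real^'m::finite"
  assumes W: "random_variable borel W" "distr M borel W = gaussian_iso \<sigma>" and \<sigma>: "0 < \<sigma>"
  shows "indep_vars (\<lambda>_. borel) (\<lambda>j \<omega>. W \<omega> $ j) UNIV"
    and "distributed M lborel (\<lambda>\<omega>. W \<omega> $ j) (normal_density 0 \<sigma>)"
proof -
  let ?D = "density lborel (\<lambda>x. ennreal (normal_density 0 \<sigma> x))"
  interpret D: prob_space ?D using \<sigma> by (rule prob_space_normal_density)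
  have [measurable]: "random_variable borel (\<lambda>\<omega>. W \<omega> $ j)" for j
    using measurable_compose[OF W(1) borel_measurable_nth] .
  have nth: "(\<lambda>z. \<lambda>j\<in>UNIV. z $ j) \<in> (borel :: (real^'m) measure) \<rightarrow>\<^sub>M PiM UNIV (\<lambda>_. borel)"
    by (intro measurable_restrict) simp
  have vec: "(\<lambda>f. \<chi> j. f j) \<in> PiM UNIV (\<lambda>_. ?D) \<rightarrow>\<^sub>M (borel :: (real^'m) measure)"
    by (rule borel_measurable_vec_lambda) simp
  have "distr M (PiM UNIV (\<lambda>_. borel)) (\<lambda>\<omega>. \<lambda>j\<in>UNIV. W \<omega> $ j)
      = distr (gaussian_iso \<sigma>) (PiM UNIV (\<lambda>_. borel)) (\<lambda>z. \<lambda>j\<in>UNIV. z $ j)"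
    unfolding W(2)[symmetric] by (subst distr_distr[OF nth W(1)]) (simp add: o_def)
  also have "\<dots> = distr (PiM UNIV (\<lambda>_. ?D)) (PiM UNIV (\<lambda>_. borel)) (\<lambda>f. f)"
    unfolding gaussian_iso_eq_distr[OF \<sigma>] distr_distr[OF nth vec]
    by (intro arg_cong[where f = "distr _ _"]) (simp add: fun_eq_iff)
  also have "\<dots> = PiM UNIV (\<lambda>_. ?D)"
    by (rule distr_id2) (simp cong: sets_PiM_cong)
  finally have joint: "distr M (PiM UNIV (\<lambda>_. borel)) (\<lambda>\<omega>. \<lambda>j\<in>UNIV. W \<omega> $ j) = PiM UNIV (\<lambda>_. ?D)" .
  have marg: "distr M borel (\<lambda>\<omega>. W \<omega> $ j) = ?D" for j
  proof -
    have "distr M borel (\<lambda>\<omega>. W \<omega> $ j)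
        = distr (distr M (PiM UNIV (\<lambda>_. borel)) (\<lambda>\<omega>. \<lambda>j\<in>UNIV. W \<omega> $ j)) borel (\<lambda>f. f j)"
      by (subst distr_distr) (auto simp: o_def intro!: measurable_restrict)
    also have "\<dots> = distr (PiM UNIV (\<lambda>_. ?D)) ?D (\<lambda>f. f j)"
      unfolding joint by (rule distr_cong) auto
    also have "\<dots> = ?D"
      by (rule distr_PiM_component) (auto intro: D.prob_space_axioms)
    finally show ?thesis .
  qed
  show "indep_vars (\<lambda>_. borel) (\<lambda>j \<omega>. W \<omega> $ j) UNIV"
    by (subst indep_vars_iff_distr_eq_PiM) (simp_all add: joint marg)
  show "distributed M lborel (\<lambda>\<omega>. W \<omega> $ j) (normal_density 0 \<sigma>)"
    unfolding distributed_def
    using marg[of j] by (auto cong: distr_cong)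
qed

lemma (in prob_space) gaussian_iso_inner:
  fixes W :: "'a \<Rightarrow> real^'m::finite"
  assumes W: "random_variable borel W" "distr M borel W = gaussian_iso \<sigma>" and \<sigma>: "0 < \<sigma>"
    and v: "v \<noteq> 0"
  shows "distributed M lborel (\<lambda>\<omega>. v \<bullet> W \<omega>) (normal_density 0 (\<sigma> * norm v))"
proof -
  have sq: "(\<Sum>j\<in>UNIV. (\<bar>v $ j\<bar> * \<sigma>)\<^sup>2) = (\<sigma> * norm v)\<^sup>2"
    by (simp add: norm_vec_def L2_set_def sum_nonneg power_mult_distrib sum_distrib_left mult.commute)
  have "distributed M lborel (\<lambda>\<omega>. \<Sum>j\<in>UNIV. v $ j * W \<omega> $ j)
      (normal_density 0 (sqrt (\<Sum>j\<in>UNIV. (\<bar>v $ j\<bar> * \<sigma>)\<^sup>2)))"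
  proof (rule sum_indep_normal_degenerate)
    show "indep_vars (\<lambda>_. borel) (\<lambda>j \<omega>. v $ j * W \<omega> $ j) UNIV"
      by (rule indep_vars_compose2[OF gaussian_iso_coordinates(1)[OF W \<sigma>]]) simp
    show "distributed M lborel (\<lambda>\<omega>. v $ j * W \<omega> $ j) (normal_density 0 (\<bar>v $ j\<bar> * \<sigma>))"
      if "0 < \<bar>v $ j\<bar> * \<sigma>" for j
      using normal_density_affine[OF gaussian_iso_coordinates(2)[OF W \<sigma>, of j] \<sigma>, of "v $ j" 0] that
      by (cases "v $ j = 0") auto
    show "(\<Sum>j\<in>UNIV. (\<bar>v $ j\<bar> * \<sigma>)\<^sup>2) \<noteq> 0" using sq \<sigma> v by simp
  qed (use \<sigma> in auto)
  then show ?thesis using \<sigma> by (simp add: sq inner_vec_def)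
qed

lemma (in prob_space)
  fixes W :: "'a \<Rightarrow> real^'m::finite" and \<sigma> :: real
  assumes W: "random_variable borel W" "distr M borel W = gaussian_iso \<sigma>" and \<sigma>: "0 \<le> \<sigma>"
  shows gaussian_iso_integrable_nth: "integrable M (\<lambda>\<omega>. W \<omega> $ j)"
    and gaussian_iso_expectation_nth: "expectation (\<lambda>\<omega>. W \<omega> $ j) = 0"
    and gaussian_iso_integrable_norm: "integrable M (\<lambda>\<omega>. (norm (W \<omega>))\<^sup>2)"
    and gaussian_iso_expectation_norm: "expectation (\<lambda>\<omega>. (norm (W \<omega>))\<^sup>2) = CARD('m) * \<sigma>\<^sup>2"
proof -
  have [measurable]: "random_variable borel (\<lambda>\<omega>. W \<omega> $ j)" for j
    using measurable_compose[OF W(1) borel_measurable_nth] .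
  have "integrable M (\<lambda>\<omega>. W \<omega> $ j) \<and> expectation (\<lambda>\<omega>. W \<omega> $ j) = 0 \<and>
      integrable M (\<lambda>\<omega>. (W \<omega> $ j)\<^sup>2) \<and> expectation (\<lambda>\<omega>. (W \<omega> $ j)\<^sup>2) = \<sigma>\<^sup>2" for j
  proof (cases "\<sigma> = 0")
    case True
    have law: "distr M borel W = return borel 0" using W(2) True by (simp add: gaussian_iso_def)
    have "AE z in distr M borel W. z = 0"
      unfolding law by (subst AE_return) auto
    then have z: "AE \<omega> in M. W \<omega> = 0" by (rule AE_distrD[OF W(1)])
    have "integrable M (\<lambda>\<omega>. W \<omega> $ j)" "integrable M (\<lambda>\<omega>. (W \<omega> $ j)\<^sup>2)"
      by (rule integrable_cong_AE_imp[of M "\<lambda>_. 0"]; use z in auto)+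
    moreover have "expectation (\<lambda>\<omega>. W \<omega> $ j) = 0" "expectation (\<lambda>\<omega>. (W \<omega> $ j)\<^sup>2) = 0"
      by (rule integral_eq_zero_AE; use z in auto)+
    ultimately show ?thesis by (simp add: True)
  next
    case False
    then have pos: "0 < \<sigma>" using \<sigma> by simp
    note D = gaussian_iso_coordinates(2)[OF W pos, of j]
    have E: "expectation (\<lambda>\<omega>. W \<omega> $ j) = 0" by (rule normal_distributed_expectation[OF pos D])
    have "integrable M (\<lambda>\<omega>. W \<omega> $ j)"
      by (rule distributed_integrable_var[OF D]) (simp_all add: integrable_normal_moment_nz_1[OF pos])
    moreover have "integrable M (\<lambda>\<omega>. (W \<omega> $ j)\<^sup>2)"
      using distributed_integrable[OF D, of "\<lambda>x. x\<^sup>2"] integrable_normal_moment[OF pos, of 0 2] by simp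
    moreover have "expectation (\<lambda>\<omega>. (W \<omega> $ j)\<^sup>2) = \<sigma>\<^sup>2"
      using normal_distributed_variance[OF pos D] by (simp add: E)
    ultimately show ?thesis using E by blast
  qed
  note * = this
  have norm: "(norm (W \<omega>))\<^sup>2 = (\<Sum>j\<in>UNIV. (W \<omega> $ j)\<^sup>2)" for \<omega>
    by (simp add: norm_vec_def L2_set_def sum_nonneg)
  show "integrable M (\<lambda>\<omega>. W \<omega> $ j)" "expectation (\<lambda>\<omega>. W \<omega> $ j) = 0" using * by auto
  show "integrable M (\<lambda>\<omega>. (norm (W \<omega>))\<^sup>2)" "expectation (\<lambda>\<omega>. (norm (W \<omega>))\<^sup>2) = CARD('m) * \<sigma>\<^sup>2"
    unfolding norm using * by (simp_all)
qed

section \<open>The Gaussian tail function\<close>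

lemma Qfun_eq_measure: "Qfun x = measure (density lborel std_normal_density) {x..}"
proof -
  have "measure (density lborel std_normal_density) {x..}
      = (LINT u|density lborel std_normal_density. indicator {x..} u)"
    by simp
  also have "\<dots> = (LINT u|lborel. std_normal_density u * indicator {x..} u)"
    by (subst integral_density) auto
  also have "\<dots> = Qfun x"
    by (simp add: Qfun_def set_lebesgue_integral_def std_normal_density_def mult_ac
        flip: integral_mult_right_zero)
  finally show ?thesis by simp
qed

lemma Qfun_eq_cdf: "Qfun x = 1 - cdf (density lborel std_normal_density) x"
proof -
  let ?D = "density lborel (\<lambda>x. ennreal (std_normal_density x))"
  interpret D: prob_space ?D by (rule prob_space_normal_density) simp
  have null: "measure ?D {x} = 0"
    by (simp add: measure_def emeasure_density nn_integral_indicator_singleton)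
  have "measure ?D {..x} = measure ?D {..<x} + measure ?D {x}"
    by (subst D.finite_measure_Union[symmetric]) (auto intro: arg_cong[where f = "measure ?D"])
  moreover have "measure ?D {..<x} = 1 - measure ?D {x..}"
    using D.prob_compl[of "{x..}"] by (auto simp: Compl_eq_Diff_UNIV[symmetric])
  ultimately show ?thesis by (simp add: Qfun_eq_measure cdf_def null)
qed

lemma Qfun_antimono: "x \<le> y \<Longrightarrow> Qfun y \<le> Qfun x"
proof -
  interpret D: prob_space "density lborel (\<lambda>x. ennreal (std_normal_density x))"
    by (rule prob_space_normal_density) simp
  show "x \<le> y \<Longrightarrow> Qfun y \<le> Qfun x"
    by (auto simp: Qfun_eq_measure intro: D.finite_measure_mono)
qed

text \<open>The normal distribution has no atoms, so its distribution function is continuous and the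
  intermediate value theorem shows that \<open>Qfun\<close> takes the value \<open>\<delta>\<close>.\<close>

lemma Qfun_inv: 
  assumes "0 < \<delta>" "\<delta> < 1"
  shows "Qfun (inv Qfun \<delta>) = \<delta>"
proof (rule f_inv_into_f)
  let ?D = "density lborel (\<lambda>x. ennreal (std_normal_density x))"
  interpret D: real_distribution ?D
    by (intro real_distribution.intro real_distribution_axioms.intro prob_space_normal_density) auto
  have cont: "isCont (cdf ?D) x" for x
    by (subst D.isCont_cdf) (simp add: measure_def emeasure_density nn_integral_indicator_singleton)
  have "eventually (\<lambda>x. cdf ?D x < 1 - \<delta>) at_bot"
    using order_tendstoD(2)[OF D.cdf_lim_at_bot, of "1 - \<delta>"] assms by simp
  then obtain a where a: "cdf ?D a < 1 - \<delta>" by (auto simp: eventually_at_bot_linorder)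
  have "eventually (\<lambda>x. cdf ?D x > 1 - \<delta>) at_top"
    using order_tendstoD(1)[OF D.cdf_lim_at_top_prob, of "1 - \<delta>"] assms by simp
  then obtain b' where b': "\<And>x. x \<ge> b' \<Longrightarrow> cdf ?D x > 1 - \<delta>" by (auto simp: eventually_at_top_linorder)
  define b where "b = max a b'"
  have "\<exists>x\<ge>a. x \<le> b \<and> cdf ?D x = 1 - \<delta>"
    by (rule IVT) (use a b'[of b] cont in \<open>auto simp: b_def\<close>)
  then obtain x where "cdf ?D x = 1 - \<delta>" by blast
  then have "\<delta> = Qfun x" by (simp add: Qfun_eq_cdf)
  then show "\<delta> \<in> range Qfun" by blast
qed

lemma (in prob_space) prob_normal_ge:
  assumes X: "distributed M lborel X (normal_density 0 s)" and s: "0 < s"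
  shows "prob {\<omega>\<in>space M. c \<le> X \<omega>} = Qfun (c / s)"
proof -
  have D: "distributed M lborel (\<lambda>\<omega>. X \<omega> / s) std_normal_density"
    using X normal_standard_normal_convert[OF s, of X 0] by simp
  have "{\<omega>\<in>space M. c \<le> X \<omega>} = (\<lambda>\<omega>. X \<omega> / s) -` {c / s..} \<inter> space M"
    using s by (auto simp: divide_right_mono field_simps)
  then show ?thesis
    using distributed_measurable[OF D] distributed_distr_eq_density[OF D]
    by (simp add: Qfun_eq_measure measure_distr flip: distributed_distr_eq_density[OF D])
qed

lemma kappa_pos:
  assumes "\<epsilon> > 0" shows "kappa \<delta> \<epsilon> > 0"
proof -
  have "\<bar>inv Qfun \<delta>\<bar> = sqrt ((inv Qfun \<delta>)\<^sup>2)" by simp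
  also have "\<dots> < sqrt ((inv Qfun \<delta>)\<^sup>2 + 2 * \<epsilon>)" using assms by (intro real_sqrt_less_mono) simp
  finally show ?thesis using assms by (simp add: kappa_def)
qed

text \<open>\<open>kappa \<delta> \<epsilon>\<close> is the positive root of the quadratic \<open>2 \<epsilon> s\<^sup>2 - 2 K s - 1\<close> with
  \<open>K = inv Qfun \<delta>\<close>.\<close>

lemma Qfun_kappa_le:
  assumes "\<epsilon> > 0" and \<delta>: "0 < \<delta>" "\<delta> < 1" and s: "kappa \<delta> \<epsilon> \<le> s"
  shows "Qfun (\<epsilon> * s - 1 / (2 * s)) \<le> \<delta>"
proof -
  define K where "K = inv Qfun \<delta>"
  define R where "R = sqrt (K\<^sup>2 + 2 * \<epsilon>)"
  have R: "R\<^sup>2 = K\<^sup>2 + 2 * \<epsilon>" using \<open>\<epsilon> > 0\<close> by (simp add: R_def add_nonneg_nonneg)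
  have "0 < s" using kappa_pos[OF \<open>\<epsilon> > 0\<close>, of \<delta>] s by linarith
  have "0 \<le> R" using \<open>\<epsilon> > 0\<close> by (simp add: R_def)
  have "K + R \<le> 2 * \<epsilon> * s"
    using s \<open>\<epsilon> > 0\<close> by (simp add: kappa_def K_def R_def field_simps)
  then have "R\<^sup>2 \<le> (2 * \<epsilon> * s - K)\<^sup>2" using \<open>0 \<le> R\<close> by (intro power_mono) auto
  then have "0 \<le> 2 * \<epsilon> * (2 * \<epsilon> * s\<^sup>2 - 2 * K * s - 1)"
    unfolding R by (simp add: power2_eq_square algebra_simps)
  then have "0 \<le> 2 * \<epsilon> * s\<^sup>2 - 2 * K * s - 1" using \<open>\<epsilon> > 0\<close> by (simp add: zero_le_mult_iff)
  then have "K \<le> \<epsilon> * s - 1 / (2 * s)"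
    using \<open>0 < s\<close> by (simp add: field_simps power2_eq_square)
  then have "Qfun (\<epsilon> * s - 1 / (2 * s)) \<le> Qfun K" by (rule Qfun_antimono)
  then show ?thesis using Qfun_inv[OF \<delta>] by (simp add: K_def)
qed

section \<open>The Gaussian mechanism\<close>

lemma distr_shift_gaussian_iso:
  fixes a :: "real^'m::finite"
  assumes \<sigma>: "0 < \<sigma>"
  shows "distr (gaussian_iso \<sigma>) borel ((+) a) = density lborel (\<lambda>z. ennreal (iso_density \<sigma> (z - a)))"
proof -
  have "density lborel (\<lambda>z. ennreal (iso_density \<sigma> (z - a)))
      = density (distr lborel borel ((+) a)) (\<lambda>z. ennreal (iso_density \<sigma> (z - a)))"
    by (simp add: lborel_distr_plus)
  also have "\<dots> = distr (density lborel (\<lambda>z. ennreal (iso_density \<sigma> z))) borel ((+) a)"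
    by (subst density_distr) simp_all
  finally show ?thesis by (simp add: gaussian_iso_eq_density[OF \<sigma>])
qed

lemma (in prob_space) distr_shifted_gaussian_family:
  fixes W :: "'t \<Rightarrow> 'a \<Rightarrow> real^'m::finite" and a :: "'t \<Rightarrow> real^'m"
  assumes I: "finite I" "I \<noteq> {}" and ind: "indep_vars (\<lambda>_. borel) W I"
    and W: "\<And>t. t \<in> I \<Longrightarrow> distr M borel (W t) = gaussian_iso \<sigma>" and \<sigma>: "0 < \<sigma>"
  shows "distr M (PiM I (\<lambda>_. borel)) (\<lambda>\<omega>. \<lambda>t\<in>I. a t + W t \<omega>)
    = density (PiM I (\<lambda>_. lborel)) (\<lambda>u. ennreal (\<Prod>t\<in>I. iso_density \<sigma> (u t - a t)))"
proof -
  have rv: "random_variable borel (W t)" if "t \<in> I" for t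
    using ind that by (auto simp: indep_vars_def)
  have marg: "distr M borel (\<lambda>\<omega>. a t + W t \<omega>) = density lborel (\<lambda>z. ennreal (iso_density \<sigma> (z - a t)))"
    if "t \<in> I" for t
    using distr_distr[of "(+) (a t)" borel borel "W t" M] rv[OF that]
    by (simp add: W[OF that] distr_shift_gaussian_iso[OF \<sigma>] o_def)
  have prob: "prob_space (density lborel (\<lambda>z. ennreal (iso_density \<sigma> (z - s))))" for s :: "real^'m"
  proof -
    obtain t where t: "t \<in> I" using I by blast
    interpret G: prob_space "gaussian_iso \<sigma> :: (real^'m) measure"
      using prob_space_distr[OF rv[OF t]] W[OF t] by simp
    have "(+) s \<in> gaussian_iso \<sigma> \<rightarrow>\<^sub>M borel"
      by (simp add: gaussian_iso_eq_density[OF \<sigma>])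
    then show ?thesis
      using G.prob_space_distr[of "(+) s" borel] by (simp add: distr_shift_gaussian_iso[OF \<sigma>])
  qed
  have "indep_vars (\<lambda>_. borel) (\<lambda>t \<omega>. a t + W t \<omega>) I"
    by (rule indep_vars_compose2[OF ind]) simp
  then have "distr M (PiM I (\<lambda>_. borel)) (\<lambda>\<omega>. \<lambda>t\<in>I. a t + W t \<omega>)
      = PiM I (\<lambda>t. distr M borel (\<lambda>\<omega>. a t + W t \<omega>))"
    using rv by (subst (asm) indep_vars_iff_distr_eq_PiM'[OF I(2)]) auto
  also have "\<dots> = PiM I (\<lambda>t. density lborel (\<lambda>z. ennreal (iso_density \<sigma> (z - a t))))"
    by (rule PiM_cong) (simp_all add: marg)
  also have "\<dots> = density (PiM I (\<lambda>_. lborel)) (\<lambda>u. \<Prod>t\<in>I. ennreal (iso_density \<sigma> (u t - a t)))"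
    by (rule density_PiM[symmetric, OF I(1)])
      (auto intro: sigma_finite_lborel prob_space_imp_sigma_finite prob)
  also have "\<dots> = density (PiM I (\<lambda>_. lborel)) (\<lambda>u. ennreal (\<Prod>t\<in>I. iso_density \<sigma> (u t - a t)))"
    by (simp add: prod_ennreal iso_density_pos[OF \<sigma>] less_imp_le)
  finally show ?thesis .
qed

lemma prod_iso_density:
  fixes h :: "'t \<Rightarrow> real^'m::finite"
  shows "(\<Prod>t\<in>I. iso_density \<sigma> (h t))
    = ((1 / sqrt (2 * pi * \<sigma>\<^sup>2)) ^ CARD('m)) ^ card I * exp (- (\<Sum>t\<in>I. (norm (h t))\<^sup>2) / (2 * \<sigma>\<^sup>2))"
proof (cases "finite I")
  case True
  then show ?thesis
    by (simp only: iso_density_eq prod.distrib exp_sum[symmetric] prod_constant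
        sum_negf[symmetric] sum_divide_distrib)
qed simp

text \<open>Where the likelihood ratio of the two shifted noise laws is at most \<open>exp \<epsilon>\<close>, the bound is
  immediate; the rest lies in a half-space whose mass under the first law is the tail
  \<open>Qfun (\<epsilon> s - 1 / (2 s))\<close>, with \<open>s\<close> the ratio of \<open>\<sigma>\<close> to the length of the shift.\<close>

lemma (in prob_space) gaussian_mechanism:
  fixes W :: "'t \<Rightarrow> 'a \<Rightarrow> real^'m::finite" and a c :: "'t \<Rightarrow> real^'m"
  assumes I: "finite I" "I \<noteq> {}" and ind: "indep_vars (\<lambda>_. borel) W I"
    and W: "\<And>t. t \<in> I \<Longrightarrow> distr M borel (W t) = gaussian_iso \<sigma>"
    and \<epsilon>: "\<epsilon> > 0" and \<delta>: "0 < \<delta>" "\<delta> < 1"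
    and \<sigma>: "kappa \<delta> \<epsilon> * sqrt (\<Sum>t\<in>I. (norm (a t - c t))\<^sup>2) \<le> \<sigma>"
    and S: "S \<in> sets (PiM I (\<lambda>_. borel))"
  shows "prob {\<omega>\<in>space M. (\<lambda>t\<in>I. a t + W t \<omega>) \<in> S}
    \<le> exp \<epsilon> * prob {\<omega>\<in>space M. (\<lambda>t\<in>I. c t + W t \<omega>) \<in> S} + \<delta>"
proof (cases "(\<Sum>t\<in>I. (norm (a t - c t))\<^sup>2) = 0")
  case True
  then have "\<And>t. t \<in> I \<Longrightarrow> a t = c t" using I by (simp add: sum_nonneg_eq_0_iff)
  then have "(\<lambda>t\<in>I. a t + W t \<omega>) = (\<lambda>t\<in>I. c t + W t \<omega>)" for \<omega> by auto
  moreover have "p \<le> exp \<epsilon> * p + \<delta>" if "0 \<le> p" for p :: real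
    using mult_right_mono[of 1 "exp \<epsilon>" p] that \<epsilon> \<delta> by simp
  ultimately show ?thesis by simp
next
  case False
  define v where "v = (\<lambda>t. a t - c t)"
  define r where "r = sqrt (\<Sum>t\<in>I. (norm (v t))\<^sup>2)"
  have "0 < (\<Sum>t\<in>I. (norm (v t))\<^sup>2)"
    using False sum_nonneg[of I "\<lambda>t. (norm (v t))\<^sup>2"] by (simp add: v_def)
  then have r: "0 < r" "r\<^sup>2 = (\<Sum>t\<in>I. (norm (v t))\<^sup>2)" by (simp_all add: r_def)
  have "kappa \<delta> \<epsilon> * r \<le> \<sigma>" using \<sigma> by (simp add: r_def v_def)
  then have \<sigma>_pos: "0 < \<sigma>" and ks: "kappa \<delta> \<epsilon> \<le> \<sigma> / r"
    using kappa_pos[OF \<epsilon>, of \<delta>] r(1) by (auto simp: field_simps intro: less_le_trans[OF mult_pos_pos])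
  have rv [measurable]: "random_variable borel (W t)" if "t \<in> I" for t
    using ind that by (auto simp: indep_vars_def)
  let ?N = "PiM I (\<lambda>_. lborel :: (real^'m) measure)"
  let ?B = "PiM I (\<lambda>_. borel :: (real^'m) measure)"
  define p where "p = (\<lambda>s u. \<Prod>t\<in>I. iso_density \<sigma> (u t - s t :: real^'m))"
  have p_pos: "0 < p s u" for s u using \<sigma>_pos by (simp add: p_def prod_pos iso_density_pos)
  have setsN: "sets ?N = sets ?B" by (rule sets_PiM_cong) simp_all
  have [measurable]: "p s \<in> borel_measurable ?N" for s
    unfolding p_def by (intro borel_measurable_prod) measurable
  have meas: "(\<lambda>\<omega>. \<lambda>t\<in>I. s t + W t \<omega>) \<in> M \<rightarrow>\<^sub>M ?B" for s
    by (intro measurable_restrict borel_measurable_add borel_measurable_const rv)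
  have law: "emeasure M {\<omega>\<in>space M. (\<lambda>t\<in>I. s t + W t \<omega>) \<in> T} = (\<integral>\<^sup>+u. ennreal (p s u) * indicator T u \<partial>?N)"
    if T: "T \<in> sets ?B" for s T
  proof -
    have "emeasure M {\<omega>\<in>space M. (\<lambda>t\<in>I. s t + W t \<omega>) \<in> T}
        = emeasure (distr M ?B (\<lambda>\<omega>. \<lambda>t\<in>I. s t + W t \<omega>)) T"
      by (subst emeasure_distr[OF meas T]) (auto intro: arg_cong[where f = "emeasure M"])
    also have "distr M ?B (\<lambda>\<omega>. \<lambda>t\<in>I. s t + W t \<omega>) = density ?N (\<lambda>u. ennreal (p s u))"
      unfolding p_def by (rule distr_shifted_gaussian_family[OF I ind W \<sigma>_pos])
    also have "emeasure \<dots> T = (\<integral>\<^sup>+u. ennreal (p s u) * indicator T u \<partial>?N)"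
      using T by (intro emeasure_density) (simp_all add: setsN)
    finally show ?thesis .
  qed
  \<comment> \<open>The outcomes for which the privacy loss exceeds \<open>\<epsilon>\<close>.\<close>
  define Z where "Z = {u \<in> space ?N. exp \<epsilon> * p c u < p a u}"
  have Z: "Z \<in> sets ?B" unfolding setsN[symmetric] Z_def by measurable
  have "emeasure M {\<omega>\<in>space M. (\<lambda>t\<in>I. a t + W t \<omega>) \<in> S}
      \<le> (\<integral>\<^sup>+u. ennreal (exp \<epsilon>) * (ennreal (p c u) * indicator S u) + ennreal (p a u) * indicator Z u \<partial>?N)"
    unfolding law[OF S]
  proof (rule nn_integral_mono)
    fix u assume u: "u \<in> space ?N"
    show "ennreal (p a u) * indicator S u
        \<le> ennreal (exp \<epsilon>) * (ennreal (p c u) * indicator S u) + ennreal (p a u) * indicator Z u"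
      using u by (cases "u \<in> Z")
        (auto simp: Z_def indicator_def ennreal_mult[symmetric] p_pos less_imp_le not_less intro!: ennreal_leI)
  qed
  also have "\<dots> = ennreal (exp \<epsilon>) * emeasure M {\<omega>\<in>space M. (\<lambda>t\<in>I. c t + W t \<omega>) \<in> S}
      + emeasure M {\<omega>\<in>space M. (\<lambda>t\<in>I. a t + W t \<omega>) \<in> Z}"
    using S Z by (subst nn_integral_add) (simp_all add: nn_integral_cmult law setsN)
  finally have split: "prob {\<omega>\<in>space M. (\<lambda>t\<in>I. a t + W t \<omega>) \<in> S}
      \<le> exp \<epsilon> * prob {\<omega>\<in>space M. (\<lambda>t\<in>I. c t + W t \<omega>) \<in> S}
        + prob {\<omega>\<in>space M. (\<lambda>t\<in>I. a t + W t \<omega>) \<in> Z}"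
    by (simp add: emeasure_eq_measure ennreal_mult[symmetric] ennreal_plus[symmetric] del: ennreal_plus)
  have "prob {\<omega>\<in>space M. (\<lambda>t\<in>I. a t + W t \<omega>) \<in> Z} \<le> \<delta>"
  proof -
    define Y where "Y = (\<lambda>\<omega>. \<Sum>t\<in>I. v t \<bullet> W t \<omega>)"
    define l where "l = \<sigma>\<^sup>2 * \<epsilon> - r\<^sup>2 / 2"
    have "distributed M lborel Y (normal_density 0 (sqrt (\<Sum>t\<in>I. (\<sigma> * norm (v t))\<^sup>2)))"
      unfolding Y_def
    proof (rule sum_indep_normal_degenerate[OF I(1)])
      show "indep_vars (\<lambda>_. borel) (\<lambda>t \<omega>. v t \<bullet> W t \<omega>) I"
        by (rule indep_vars_compose2[OF ind]) simp
      show "distributed M lborel (\<lambda>\<omega>. v t \<bullet> W t \<omega>) (normal_density 0 (\<sigma> * norm (v t)))"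
        if "t \<in> I" "0 < \<sigma> * norm (v t)" for t
        using that by (intro gaussian_iso_inner rv W \<sigma>_pos) auto
      show "(\<Sum>t\<in>I. (\<sigma> * norm (v t))\<^sup>2) \<noteq> 0"
        using r(1) \<sigma>_pos by (simp add: power_mult_distrib sum_distrib_left[symmetric] flip: r(2))
    qed (use \<sigma>_pos in auto)
    also have "sqrt (\<Sum>t\<in>I. (\<sigma> * norm (v t))\<^sup>2) = \<sigma> * r"
      using \<sigma>_pos r(1) by (simp add: power_mult_distrib sum_distrib_left[symmetric] real_sqrt_mult flip: r(2))
    finally have Y: "distributed M lborel Y (normal_density 0 (\<sigma> * r))" .
    have "l \<le> Y \<omega>" if "(\<lambda>t\<in>I. a t + W t \<omega>) \<in> Z" for \<omega>
    proof -
      define C where "C = ((1 / sqrt (2 * pi * \<sigma>\<^sup>2)) ^ CARD('m)) ^ card I"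
      have "0 < C" using \<sigma>_pos by (simp add: C_def)
      have pa: "p a (\<lambda>t\<in>I. a t + W t \<omega>) = C * exp (- (\<Sum>t\<in>I. (norm (W t \<omega>))\<^sup>2) / (2 * \<sigma>\<^sup>2))"
        unfolding p_def C_def prod_iso_density by simp
      have pc: "p c (\<lambda>t\<in>I. a t + W t \<omega>) = C * exp (- (\<Sum>t\<in>I. (norm (v t + W t \<omega>))\<^sup>2) / (2 * \<sigma>\<^sup>2))"
        unfolding p_def C_def prod_iso_density by (simp add: v_def algebra_simps)
      have "(\<Sum>t\<in>I. (norm (v t + W t \<omega>))\<^sup>2) = (\<Sum>t\<in>I. (norm (v t))\<^sup>2 + 2 * (v t \<bullet> W t \<omega>) + (norm (W t \<omega>))\<^sup>2)"
        by (intro sum.cong refl) (simp add: power2_norm_eq_inner inner_simps inner_commute)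
      also have "\<dots> = r\<^sup>2 + 2 * Y \<omega> + (\<Sum>t\<in>I. (norm (W t \<omega>))\<^sup>2)"
        by (simp add: sum.distrib r(2) Y_def sum_distrib_left)
      finally have sq: "(\<Sum>t\<in>I. (norm (v t + W t \<omega>))\<^sup>2) = r\<^sup>2 + 2 * Y \<omega> + (\<Sum>t\<in>I. (norm (W t \<omega>))\<^sup>2)" .
      have "exp \<epsilon> * p c (\<lambda>t\<in>I. a t + W t \<omega>) < p a (\<lambda>t\<in>I. a t + W t \<omega>)"
        using that by (simp add: Z_def)
      then have "C * exp (\<epsilon> + - (r\<^sup>2 + 2 * Y \<omega> + (\<Sum>t\<in>I. (norm (W t \<omega>))\<^sup>2)) / (2 * \<sigma>\<^sup>2))
          < C * exp (- (\<Sum>t\<in>I. (norm (W t \<omega>))\<^sup>2) / (2 * \<sigma>\<^sup>2))"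
        unfolding pa pc sq exp_add by (simp only: mult_ac)
      then have "\<epsilon> + - (r\<^sup>2 + 2 * Y \<omega> + (\<Sum>t\<in>I. (norm (W t \<omega>))\<^sup>2)) / (2 * \<sigma>\<^sup>2)
          < - (\<Sum>t\<in>I. (norm (W t \<omega>))\<^sup>2) / (2 * \<sigma>\<^sup>2)"
        using \<open>0 < C\<close> by simp
      then have "\<epsilon> < (r\<^sup>2 + 2 * Y \<omega>) / (2 * \<sigma>\<^sup>2)"
        by (simp add: add_divide_distrib diff_divide_distrib)
      then show ?thesis using \<sigma>_pos by (simp add: l_def pos_less_divide_eq mult_ac)
    qed
    then have "prob {\<omega>\<in>space M. (\<lambda>t\<in>I. a t + W t \<omega>) \<in> Z} \<le> prob {\<omega>\<in>space M. l \<le> Y \<omega>}"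
      using distributed_measurable[OF Y] by (intro finite_measure_mono) (auto simp: measurable_lborel1)
    also have "\<dots> = Qfun (l / (\<sigma> * r))"
      using Y \<sigma>_pos r(1) by (intro prob_normal_ge) auto
    also have "l / (\<sigma> * r) = \<epsilon> * (\<sigma> / r) - 1 / (2 * (\<sigma> / r))"
      using \<sigma>_pos r(1) by (simp add: l_def field_simps power2_eq_square)
    also have "Qfun \<dots> \<le> \<delta>" by (rule Qfun_kappa_le[OF \<epsilon> \<delta> ks])
    finally show ?thesis .
  qed
  with split show ?thesis by linarith
qed

lemma lipschitz_const_attained:
  assumes "C-lipschitz_on S F"
  shows "(lipschitz_const S F)-lipschitz_on S F"
proof (rule lipschitz_onI)
  let ?L = "{C. C-lipschitz_on S F}"
  have ne: "?L \<noteq> {}" using assms by blast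
  show "0 \<le> lipschitz_const S F"
    unfolding lipschitz_const_def by (rule cInf_greatest[OF ne]) (auto dest: lipschitz_on_nonneg)
  fix x y assume xy: "x \<in> S" "y \<in> S"
  show "dist (F x) (F y) \<le> lipschitz_const S F * dist x y"
  proof (cases "x = y")
    case False
    have "dist (F x) (F y) / dist x y \<le> lipschitz_const S F"
      unfolding lipschitz_const_def
      by (rule cInf_greatest[OF ne]) (use False xy in \<open>auto simp: field_simps dest: lipschitz_onD\<close>)
    then show ?thesis using False by (simp add: field_simps)
  qed simp
qed

text \<open>A Lipschitz map enlarges the \<open>\<ell>\<^sub>2\<close> distance of two signals, over any finite horizon, by at most its
  constant. The bound does not grow with the horizon, so one noise level serves all \<open>k\<close>.\<close>

lemma (in prob_space) gaussian_differentially_private: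
  fixes h :: "real^'n::finite \<Rightarrow> real^'m::finite" and W :: "nat \<Rightarrow> 'a \<Rightarrow> real^'m"
  assumes h: "C-lipschitz_on X h"
    and ind: "indep_vars (\<lambda>_. borel) W UNIV"
    and W: "\<And>t. distr M borel (W t) = gaussian_iso \<sigma>"
    and \<epsilon>: "\<epsilon> > 0" and \<delta>: "0 < \<delta>" "\<delta> < 1"
    and \<sigma>: "kappa \<delta> \<epsilon> * lipschitz_const X h * Max (range b) \<le> \<sigma>"
  shows "differentially_private M (input_signals X) (adj b) \<epsilon> \<delta> (\<lambda>x k \<omega>. h (x k) + W k \<omega>)"
  unfolding differentially_private_def
proof (intro conjI ballI allI impI)
  have [measurable]: "random_variable borel (W t)" for t
    using ind by (auto simp: indep_vars_def)
  show "(\<lambda>\<omega>. h (x k) + W k \<omega>) \<in> borel_measurable M" for x k by simp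
  fix x y :: "nat \<Rightarrow> real^'n" and k :: nat and S
  assume x: "x \<in> input_signals X" and y: "y \<in> input_signals X" and "adj b x y"
    and S: "S \<in> sets (PiM {..k} (\<lambda>_. borel :: (real^'m) measure))"
  define K where "K = lipschitz_const X h"
  have K: "K-lipschitz_on X h" unfolding K_def by (rule lipschitz_const_attained[OF h])
  from \<open>adj b x y\<close> obtain i where sm: "summable (\<lambda>k. \<bar>x k $ i - y k $ i\<bar>\<^sup>2)"
    and le: "sqrt (\<Sum>k. \<bar>x k $ i - y k $ i\<bar>\<^sup>2) \<le> b i"
    and eq: "\<And>j t. j \<noteq> i \<Longrightarrow> x t $ j = y t $ j"
    unfolding adj_def by blast
  have norm: "norm (x t - y t) = \<bar>x t $ i - y t $ i\<bar>" for t
  proof -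
    have "x t - y t = (x t $ i - y t $ i) *\<^sub>R axis i 1"
      by (auto simp: vec_eq_iff axis_def eq)
    then have "norm (x t - y t) = norm ((x t $ i - y t $ i) *\<^sub>R (axis i 1 :: real^'n))" by simp
    then show ?thesis by simp
  qed
  have "(\<Sum>t\<le>k. (norm (h (x t) - h (y t)))\<^sup>2) \<le> (\<Sum>t\<le>k. (K * \<bar>x t $ i - y t $ i\<bar>)\<^sup>2)"
    using x y lipschitz_on_normD[OF K] by (intro sum_mono power_mono) (auto simp: input_signals_def norm[symmetric])
  also have "\<dots> = K\<^sup>2 * (\<Sum>t\<le>k. \<bar>x t $ i - y t $ i\<bar>\<^sup>2)"
    by (simp add: power_mult_distrib sum_distrib_left)
  also have "\<dots> \<le> K\<^sup>2 * (\<Sum>t. \<bar>x t $ i - y t $ i\<bar>\<^sup>2)"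
    by (intro mult_left_mono sum_le_suminf[OF sm]) auto
  finally have "sqrt (\<Sum>t\<le>k. (norm (h (x t) - h (y t)))\<^sup>2) \<le> sqrt (K\<^sup>2 * (\<Sum>t. \<bar>x t $ i - y t $ i\<bar>\<^sup>2))"
    by (rule real_sqrt_le_mono)
  also have "\<dots> = K * sqrt (\<Sum>t. \<bar>x t $ i - y t $ i\<bar>\<^sup>2)"
    using lipschitz_on_nonneg[OF K] by (simp add: real_sqrt_mult)
  also have "\<dots> \<le> K * Max (range b)"
    using lipschitz_on_nonneg[OF K] order_trans[OF le Max_ge[of "range b" "b i"]] by (intro mult_left_mono) auto
  finally have "kappa \<delta> \<epsilon> * sqrt (\<Sum>t\<le>k. (norm (h (x t) - h (y t)))\<^sup>2) \<le> kappa \<delta> \<epsilon> * (K * Max (range b))"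
    using kappa_pos[OF \<epsilon>, of \<delta>] by (intro mult_left_mono) auto
  also have "\<dots> \<le> \<sigma>" using \<sigma> by (simp add: K_def mult.assoc)
  finally show "prob {\<omega>\<in>space M. (\<lambda>t\<in>{..k}. h (x t) + W t \<omega>) \<in> S}
      \<le> exp \<epsilon> * prob {\<omega>\<in>space M. (\<lambda>t\<in>{..k}. h (y t) + W t \<omega>) \<in> S} + \<delta>"
    by (intro gaussian_mechanism[OF _ _ indep_vars_subset[OF ind] W \<epsilon> \<delta> _ S]) auto
qed

section \<open>Twice continuously differentiable maps\<close>

lemma continuous_derivative_imp_lipschitz:
  fixes F :: "'a::euclidean_space \<Rightarrow> 'b::real_normed_vector"
  assumes F: "\<And>x. (F has_derivative blinfun_apply (F' x)) (at x)" and F': "continuous_on UNIV F'"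
    and X: "compact X" "convex X"
  shows "\<exists>C. C-lipschitz_on X F"
proof -
  have "bounded (F' ` X)"
    using X F' by (intro compact_imp_bounded compact_continuous_image) (auto intro: continuous_on_subset)
  then obtain C where C: "\<And>x. x \<in> X \<Longrightarrow> norm (F' x) \<le> C" and "0 < C"
    by (auto simp: bounded_pos)
  have "C-lipschitz_on X F"
  proof (rule bounded_derivative_imp_lipschitz[where f' = "\<lambda>x. blinfun_apply (F' x)"])
    show "(F has_derivative blinfun_apply (F' x)) (at x within X)" for x
      using F by (rule has_derivative_at_withinI)
    show "onorm (blinfun_apply (F' x)) \<le> C" if "x \<in> X" for x
      using C[OF that] by (simp add: norm_blinfun.rep_eq)
  qed (use X \<open>0 < C\<close> in auto)
  then show ?thesis ..
qed

lemma C2_obtain_derivative: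
  assumes "C2 F"
  obtains F' where "\<And>x. (F has_derivative blinfun_apply (F' x)) (at x)" "continuous_on UNIV F'"
    "\<And>X. compact X \<Longrightarrow> convex X \<Longrightarrow> \<exists>C. C-lipschitz_on X F'"
proof -
  obtain F' F'' where F': "\<And>x. (F has_derivative blinfun_apply (F' x)) (at x)"
    and F'': "\<And>x. (F' has_derivative blinfun_apply (F'' x)) (at x)" "continuous_on UNIV F''"
    using assms unfolding C2_def by blast
  have "continuous_on UNIV F'"
    by (simp add: continuous_on_eq_continuous_at has_derivative_continuous[OF F''(1)])
  then show ?thesis
    using that[OF F'] continuous_derivative_imp_lipschitz[OF F''] by blast
qed

lemma lipschitz_on_vecI:
  fixes h :: "'a::metric_space \<Rightarrow> real^'m::finite"
  assumes "\<And>j. \<exists>C. C-lipschitz_on X (\<lambda>x. h x $ j)"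
  shows "\<exists>C. C-lipschitz_on X h"
proof -
  obtain C where C: "\<And>j. (C j)-lipschitz_on X (\<lambda>x. h x $ j)" using assms by metis
  have "(\<Sum>j\<in>UNIV. C j)-lipschitz_on X h"
  proof (rule lipschitz_onI)
    show "0 \<le> (\<Sum>j\<in>UNIV. C j)" using C by (intro sum_nonneg) (auto dest: lipschitz_on_nonneg)
    fix x y assume "x \<in> X" "y \<in> X"
    have "dist (h x) (h y) \<le> (\<Sum>j\<in>UNIV. \<bar>(h x - h y) $ j\<bar>)"
      unfolding dist_norm by (rule norm_le_l1_cart)
    also have "\<dots> \<le> (\<Sum>j\<in>UNIV. C j * dist x y)"
      using lipschitz_onD[OF C \<open>x \<in> X\<close> \<open>y \<in> X\<close>] by (intro sum_mono) (simp add: dist_real_def)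
    finally show "dist (h x) (h y) \<le> (\<Sum>j\<in>UNIV. C j) * dist x y" by (simp add: sum_distrib_right)
  qed
  then show ?thesis ..
qed

lemma partial_deriv_eq:
  assumes "(F has_derivative D) (at x)"
  shows "partial_deriv F i x = D (axis i 1)"
proof -
  have line: "((\<lambda>t::real. x + t *\<^sub>R axis i 1) has_derivative (\<lambda>t. t *\<^sub>R axis i 1)) (at 0)"
    by (auto intro!: derivative_eq_intros)
  have "((F \<circ> (\<lambda>t::real. x + t *\<^sub>R axis i 1)) has_derivative (D \<circ> (\<lambda>t. t *\<^sub>R axis i 1))) (at 0)"
    using assms by (intro diff_chain_at[OF line]) simp
  then have "((\<lambda>t::real. F (x + t *\<^sub>R axis i 1)) has_vector_derivative D (axis i 1)) (at 0)"
    using linear_cmul[OF has_derivative_linear[OF assms]]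
    by (simp add: has_vector_derivative_def o_def)
  then show ?thesis unfolding partial_deriv_def by (rule vector_derivative_at)
qed

lemma sum_partial_deriv:
  fixes D :: "real^'n::finite \<Rightarrow> 'b::real_normed_vector"
  assumes "(F has_derivative D) (at x)"
  shows "(\<Sum>i\<in>UNIV. h $ i *\<^sub>R partial_deriv F i x) = D h"
proof -
  have lin: "linear D" using assms by (rule has_derivative_linear)
  have "D h = D (\<Sum>i\<in>UNIV. h $ i *\<^sub>R axis i 1)"
    using basis_expansion[of h] by (simp add: scalar_mult_eq_scaleR)
  also have "\<dots> = (\<Sum>i\<in>UNIV. h $ i *\<^sub>R D (axis i 1))"
    by (simp add: linear_sum[OF lin] linear_cmul[OF lin])
  finally show ?thesis by (simp add: partial_deriv_eq[OF assms])
qed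

text \<open>On the line through \<open>x\<close> and \<open>y\<close> this is the tangent inequality for a convex function of one real
  variable.\<close>

lemma convex_gradient_inequality:
  fixes F :: "'a::real_normed_vector \<Rightarrow> real"
  assumes cvx: "convex_on UNIV F" and D: "(F has_derivative D) (at x)"
  shows "F x + D (y - x) \<le> F y"
proof -
  let ?h = "\<lambda>t::real. F (x + t *\<^sub>R (y - x))"
  have line: "((\<lambda>t::real. x + t *\<^sub>R (y - x)) has_derivative (\<lambda>t. t *\<^sub>R (y - x))) (at 0)"
    by (auto intro!: derivative_eq_intros)
  have "((F \<circ> (\<lambda>t. x + t *\<^sub>R (y - x))) has_derivative (D \<circ> (\<lambda>t. t *\<^sub>R (y - x)))) (at 0)"
    using D by (intro diff_chain_at[OF line]) simp
  then have deriv: "(?h has_field_derivative D (y - x)) (at 0)"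
    using linear_cmul[OF has_derivative_linear[OF D]]
    by (simp add: has_field_derivative_def o_def mult_commute_abs)
  have "convex_on UNIV ?h"
  proof (rule convex_onI)
    fix t r s :: real assume "0 < t" "t < 1"
    have "x + ((1 - t) *\<^sub>R r + t *\<^sub>R s) *\<^sub>R (y - x)
        = (1 - t) *\<^sub>R (x + r *\<^sub>R (y - x)) + t *\<^sub>R (x + s *\<^sub>R (y - x))"
      by (simp add: algebra_simps)
    then show "?h ((1 - t) *\<^sub>R r + t *\<^sub>R s) \<le> (1 - t) * ?h r + t * ?h s"
      using convex_onD[OF cvx, of t] \<open>0 < t\<close> \<open>t < 1\<close> by simp
  qed simp
  from convex_on_imp_above_tangent[OF this, of 0 1 "D (y - x)"] deriv show ?thesis by simp
qed

section \<open>The saddle point operator of a convex program\<close>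

locale convex_program =
  fixes X :: "(real^'n::finite) set"
    and f :: "'n \<Rightarrow> real \<Rightarrow> real"
    and g :: "real^'n \<Rightarrow> real^'m::finite"
    and xhat :: "real^'n" and muhat :: "real^'m"
  assumes X: "X \<noteq> {}" "compact X" "convex X"
    and f: "\<And>i. convex_on UNIV (f i)" "\<And>i. C2 (f i)"
    and g: "\<And>j. convex_on UNIV (\<lambda>x. g x $ j)" "\<And>j. C2 (\<lambda>x. g x $ j)"
    and saddle: "is_saddle_point (lagrangian f g) X nonneg_orthant xhat muhat"
    and saddle_unique: "\<And>x \<mu>. is_saddle_point (lagrangian f g) X nonneg_orthant x \<mu> \<Longrightarrow>
      x = xhat \<and> \<mu> = muhat"
begin

definition Df :: "'n \<Rightarrow> real \<Rightarrow> real \<Rightarrow>\<^sub>L real" where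
  "Df = (SOME D. \<forall>i. (\<forall>x. (f i has_derivative blinfun_apply (D i x)) (at x)) \<and> continuous_on UNIV (D i))"

lemma Df: "(f i has_derivative blinfun_apply (Df i x)) (at x)" "continuous_on UNIV (Df i)"
proof -
  have "\<exists>D. \<forall>i. (\<forall>x. (f i has_derivative blinfun_apply (D i x)) (at x)) \<and> continuous_on UNIV (D i)"
    by (rule choice) (metis C2_obtain_derivative[OF f(2)])
  from someI_ex[OF this] show "(f i has_derivative blinfun_apply (Df i x)) (at x)" "continuous_on UNIV (Df i)"
    unfolding Df_def by blast+
qed

definition Dg :: "'m \<Rightarrow> real^'n \<Rightarrow> (real^'n) \<Rightarrow>\<^sub>L real" where
  "Dg = (SOME D. \<forall>j. (\<forall>x. ((\<lambda>x. g x $ j) has_derivative blinfun_apply (D j x)) (at x)) \<and>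
     continuous_on UNIV (D j) \<and> (\<exists>C. C-lipschitz_on X (D j)))"

lemma Dg: "((\<lambda>x. g x $ j) has_derivative blinfun_apply (Dg j x)) (at x)" "continuous_on UNIV (Dg j)"
    "\<exists>C. C-lipschitz_on X (Dg j)"
proof -
  have "\<exists>D. \<forall>j. (\<forall>x. ((\<lambda>x. g x $ j) has_derivative blinfun_apply (D j x)) (at x)) \<and>
     continuous_on UNIV (D j) \<and> (\<exists>C. C-lipschitz_on X (D j))"
    by (rule choice) (metis C2_obtain_derivative[OF g(2)] X(2,3))
  from someI_ex[OF this] show "((\<lambda>x. g x $ j) has_derivative blinfun_apply (Dg j x)) (at x)"
      "continuous_on UNIV (Dg j)" "\<exists>C. C-lipschitz_on X (Dg j)"
    unfolding Dg_def by blast+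
qed

lemma has_derivative_g: "(g has_derivative (\<lambda>h. \<chi> j. Dg j x h)) (at x)"
proof (subst has_derivative_componentwise_within, rule ballI)
  fix b :: "real^'m" assume "b \<in> Basis"
  then obtain j where "b = axis j 1" by (auto simp: Basis_vec_def)
  then show "((\<lambda>x. g x \<bullet> b) has_derivative (\<lambda>h. (\<chi> j. Dg j x h) \<bullet> b)) (at x)"
    using Dg(1)[of j x] by (simp add: inner_axis)
qed

lemma partial_deriv_g_nth: "partial_deriv g i x $ j = Dg j x (axis i 1)"
  by (simp add: partial_deriv_eq[OF has_derivative_g])

lemma lipschitz_g: "\<exists>C. C-lipschitz_on X g"
  using continuous_derivative_imp_lipschitz[OF Dg(1,2) X(2,3)] by (rule lipschitz_on_vecI)

lemma lipschitz_partial_deriv_g: "\<exists>C. C-lipschitz_on X (partial_deriv g i)"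
proof (rule lipschitz_on_vecI)
  fix j
  obtain C where C: "C-lipschitz_on X (Dg j)" using Dg(3) by blast
  have "C-lipschitz_on X (\<lambda>x. partial_deriv g i x $ j)"
  proof (rule lipschitz_onI)
    fix x y assume xy: "x \<in> X" "y \<in> X"
    have "dist (partial_deriv g i x $ j) (partial_deriv g i y $ j) = norm ((Dg j x - Dg j y) (axis i 1))"
      by (simp add: partial_deriv_g_nth dist_norm blinfun.diff_left)
    also have "\<dots> \<le> norm (Dg j x - Dg j y)"
      using norm_blinfun[of "Dg j x - Dg j y" "axis i 1"] by simp
    also have "\<dots> \<le> C * dist x y" using lipschitz_onD[OF C xy] by (simp add: dist_norm)
    finally show "dist (partial_deriv g i x $ j) (partial_deriv g i y $ j) \<le> C * dist x y" .
  qed (rule lipschitz_on_nonneg[OF C])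
  then show "\<exists>C. C-lipschitz_on X (\<lambda>x. partial_deriv g i x $ j)" ..
qed

lemma has_derivative_total_cost:
  "(total_cost f has_derivative (\<lambda>h. \<Sum>i\<in>UNIV. Df i (x $ i) (h $ i))) (at x)"
  unfolding total_cost_def[abs_def]
proof (rule has_derivative_sum)
  fix i
  have "((\<lambda>x::real^'n. x $ i) has_derivative (\<lambda>h. h $ i)) (at x)"
    by (rule bounded_linear_imp_has_derivative) (rule bounded_linear_vec_nth)
  then show "((\<lambda>x. f i (x $ i)) has_derivative (\<lambda>h. Df i (x $ i) (h $ i))) (at x)"
    using diff_chain_at[OF _ Df(1)] by (fastforce simp: o_def)
qed

lemma grad_total_cost: "grad (total_cost f) x = (\<chi> i. Df i (x $ i) 1)"
  by (simp add: grad_def partial_deriv_eq[OF has_derivative_total_cost] axis_def if_distrib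
      blinfun.zero_right cong: if_cong)

lemma continuous_grad_total_cost: "continuous_on UNIV (grad (total_cost f))"
proof -
  have "continuous_on UNIV (\<lambda>x::real^'n. Df i (x $ i))" for i
    by (rule continuous_on_compose2[OF Df(2)])
      (auto intro: linear_continuous_on bounded_linear_vec_nth)
  then show ?thesis
    unfolding grad_total_cost[abs_def]
    by (intro continuous_on_vec_lambda continuous_intros)
qed

lemma continuous_partial_deriv_g: "continuous_on UNIV (partial_deriv g i)"
proof -
  have eq: "partial_deriv g i = (\<lambda>x. \<chi> j. Dg j x (axis i 1))"
    by (simp add: fun_eq_iff vec_eq_iff partial_deriv_g_nth)
  show ?thesis
    unfolding eq by (intro continuous_on_vec_lambda continuous_intros Dg(2))
qed

lemma continuous_g: "continuous_on UNIV g"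
  using has_derivative_continuous[OF has_derivative_g] by (simp add: continuous_at_imp_continuous_on)

definition primal_grad :: "real^'n \<Rightarrow> real^'m \<Rightarrow> real^'n" where
  "primal_grad x \<mu> = grad (total_cost f) x + (\<chi> i. partial_deriv g i x \<bullet> \<mu>)"

lemma lagrangian_gradient_inequality:
  assumes "\<mu> \<in> nonneg_orthant"
  shows "lagrangian f g x \<mu> + primal_grad x \<mu> \<bullet> (y - x) \<le> lagrangian f g y \<mu>"
proof -
  have "total_cost f x + grad (total_cost f) x \<bullet> (y - x)
      = (\<Sum>i\<in>UNIV. f i (x $ i) + Df i (x $ i) (y $ i - x $ i))"
    using blinfun.scaleR_right[of "Df i (x $ i)" "y $ i - x $ i" 1 for i]
    by (simp add: total_cost_def grad_total_cost inner_vec_def sum.distrib mult.commute)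
  also have "\<dots> \<le> total_cost f y"
    unfolding total_cost_def by (intro sum_mono convex_gradient_inequality f(1) Df(1))
  finally have 1: "total_cost f x + grad (total_cost f) x \<bullet> (y - x) \<le> total_cost f y" .
  have "(\<chi> i. partial_deriv g i x \<bullet> \<mu>) \<bullet> h = \<mu> \<bullet> (\<Sum>i\<in>UNIV. h $ i *\<^sub>R partial_deriv g i x)" for h
    unfolding inner_sum_right inner_vec_def[of "\<chi> i. partial_deriv g i x \<bullet> \<mu>" h]
    by (simp add: inner_commute[of _ \<mu>] mult.commute)
  then have "\<mu> \<bullet> g x + (\<chi> i. partial_deriv g i x \<bullet> \<mu>) \<bullet> (y - x)
      = \<mu> \<bullet> (g x + (\<chi> j. Dg j x (y - x)))"
    by (simp add: sum_partial_deriv[OF has_derivative_g] inner_add_right)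
  also have "\<dots> \<le> \<mu> \<bullet> g y"
    unfolding inner_vec_def using assms
    by (intro sum_mono) (auto simp: nonneg_orthant_def intro!: mult_left_mono convex_gradient_inequality[OF g(1) Dg(1)])
  finally show ?thesis using 1 by (simp add: lagrangian_def primal_grad_def inner_add_left)
qed

definition saddle_op :: "(real^'n) \<times> (real^'m) \<Rightarrow> (real^'n) \<times> (real^'m)" where
  "saddle_op z = (primal_grad (fst z) (snd z), - g (fst z))"

lemma closed_nonneg_orthant: "closed (nonneg_orthant :: (real^'m) set)"
  unfolding nonneg_orthant_def by (intro closed_Collect_all closed_Collect_le continuous_intros)

lemma convex_nonneg_orthant: "convex (nonneg_orthant :: (real^'m) set)"
  by (auto simp: nonneg_orthant_def convex_def)

lemma zero_in_nonneg_orthant: "0 \<in> nonneg_orthant"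
  by (simp add: nonneg_orthant_def)

text \<open>The sum of this inequality and the one with \<open>z\<close> and \<open>u\<close> exchanged has left-hand side \<open>0\<close>; this is
  the monotonicity of the operator. With \<open>u\<close> the saddle point the left-hand side is nonnegative,
  which is \<open>minty\<close>.\<close>

lemma saddle_op_inner_ge:
  assumes "snd z \<in> nonneg_orthant"
  shows "lagrangian f g (fst z) (snd u) - lagrangian f g (fst u) (snd z) \<le> saddle_op z \<bullet> (z - u)"
  using lagrangian_gradient_inequality[OF assms, of "fst z" "fst u"]
  by (simp add: saddle_op_def inner_prod_def lagrangian_def inner_diff_right inner_diff_left inner_commute)

lemma continuous_saddle_op: "continuous_on UNIV saddle_op"
  unfolding saddle_op_def[abs_def] primal_grad_def
  by (intro continuous_intros continuous_on_vec_lambda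
      continuous_on_compose2[OF continuous_grad_total_cost]
      continuous_on_compose2[OF continuous_partial_deriv_g]
      continuous_on_compose2[OF continuous_g]) auto

sublocale saddle: monotone_vi "X \<times> nonneg_orthant" saddle_op "(xhat, muhat)"
proof
  show "closed (X \<times> (nonneg_orthant :: (real^'m) set))"
    by (rule closed_Times[OF compact_imp_closed[OF X(2)] closed_nonneg_orthant])
  show "convex (X \<times> (nonneg_orthant :: (real^'m) set))"
    using X convex_nonneg_orthant by (intro convex_Times)
  show "continuous_on (X \<times> nonneg_orthant) saddle_op"
    using continuous_saddle_op by (rule continuous_on_subset) simp
  fix z assume z: "z \<in> X \<times> (nonneg_orthant :: (real^'m) set)"
  show "0 \<le> (saddle_op z - saddle_op u) \<bullet> (z - u)" if "u \<in> X \<times> nonneg_orthant" for u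
    using saddle_op_inner_ge[of z u] saddle_op_inner_ge[of u z] z that
    by (auto simp: inner_diff_left inner_diff_right)
  show "0 \<le> saddle_op z \<bullet> (z - (xhat, muhat))"
  proof -
    have xm: "fst z \<in> X" "snd z \<in> nonneg_orthant" using z by auto
    then have "lagrangian f g xhat (snd z) \<le> lagrangian f g (fst z) muhat"
      using saddle unfolding is_saddle_point_def by (meson order_trans)
    then show ?thesis using saddle_op_inner_ge[OF xm(2), of "(xhat, muhat)"] by simp
  qed
  assume vi: "\<And>u. u \<in> X \<times> nonneg_orthant \<Longrightarrow> 0 \<le> saddle_op z \<bullet> (u - z)"
  have "is_saddle_point (lagrangian f g) X nonneg_orthant (fst z) (snd z)"
    unfolding is_saddle_point_def
  proof (intro conjI ballI)
    fix x \<mu> assume "x \<in> X" "\<mu> \<in> (nonneg_orthant :: (real^'m) set)"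
    show "lagrangian f g (fst z) \<mu> \<le> lagrangian f g (fst z) (snd z)"
      using vi[of "(fst z, \<mu>)"] z \<open>\<mu> \<in> nonneg_orthant\<close>
      by (auto simp: saddle_op_def inner_prod_def lagrangian_def inner_diff_right inner_commute)
    show "lagrangian f g (fst z) (snd z) \<le> lagrangian f g x (snd z)"
      using vi[of "(x, snd z)"] z \<open>x \<in> X\<close> lagrangian_gradient_inequality[of "snd z" "fst z" x]
      by (auto simp: saddle_op_def inner_prod_def)
  qed (use z in auto)
  then show "z = (xhat, muhat)" using saddle_unique by (metis prod.collapse)
next
  show "(xhat, muhat) \<in> X \<times> nonneg_orthant" using saddle by (simp add: is_saddle_point_def)
qed

text \<open>Of the two components only the multiplier is unbounded, and the operator is affine in it.\<close>

lemma saddle_op_linear_growth: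
  "\<exists>C>0. \<forall>z. fst z \<in> X \<longrightarrow> norm (saddle_op z) \<le> C * (1 + norm (snd z))"
proof -
  have bd: "\<exists>C>0. \<forall>x\<in>X. norm (h x) \<le> C" if "continuous_on UNIV h" for h :: "real^'n \<Rightarrow> real^'k"
  proof -
    have "bounded (h ` X)"
      using X that by (intro compact_imp_bounded compact_continuous_image) (auto intro: continuous_on_subset)
    then show ?thesis by (auto simp: bounded_pos)
  qed
  obtain C1 where C1: "C1 > 0" "\<And>x. x \<in> X \<Longrightarrow> norm (grad (total_cost f) x) \<le> C1"
    using bd[OF continuous_grad_total_cost] by blast
  obtain C2 where C2: "C2 > 0" "\<And>x. x \<in> X \<Longrightarrow> norm (g x) \<le> C2"
    using bd[OF continuous_g] by blast
  have "\<forall>i. \<exists>C>0. \<forall>x\<in>X. norm (partial_deriv g i x) \<le> C"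
    using bd[OF continuous_partial_deriv_g] by blast
  then obtain K where K: "\<And>i. K i > 0" "\<And>i x. x \<in> X \<Longrightarrow> norm (partial_deriv g i x) \<le> K i"
    by metis
  have Kn: "0 \<le> (\<Sum>i\<in>UNIV. K i)" using K(1) by (intro sum_nonneg) (auto intro: less_imp_le)
  have "norm (saddle_op z) \<le> (C1 + C2 + (\<Sum>i\<in>UNIV. K i)) * (1 + norm (snd z))"
    if x: "fst z \<in> X" for z
  proof -
    have "norm (\<chi> i. partial_deriv g i (fst z) \<bullet> snd z) \<le> (\<Sum>i\<in>UNIV. \<bar>partial_deriv g i (fst z) \<bullet> snd z\<bar>)"
      using norm_le_l1_cart[of "\<chi> i. partial_deriv g i (fst z) \<bullet> snd z"] by simp
    also have "\<dots> \<le> (\<Sum>i\<in>UNIV. K i * norm (snd z))"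
      by (intro sum_mono order_trans[OF Cauchy_Schwarz_ineq2 mult_right_mono[OF K(2)[OF x] norm_ge_zero]])
    also have "\<dots> = (\<Sum>i\<in>UNIV. K i) * norm (snd z)" by (simp add: sum_distrib_right)
    finally have "norm (primal_grad (fst z) (snd z)) \<le> C1 + (\<Sum>i\<in>UNIV. K i) * norm (snd z)"
      unfolding primal_grad_def using C1(2)[OF x] by (intro order_trans[OF norm_triangle_ineq]) simp
    then have "norm (saddle_op z) \<le> C1 + (\<Sum>i\<in>UNIV. K i) * norm (snd z) + C2"
      using norm_Pair_le[of "primal_grad (fst z) (snd z)" "- g (fst z)"] C2(2)[OF x]
      by (simp add: saddle_op_def)
    moreover have "0 \<le> (C1 + C2) * norm (snd z)" using C1(1) C2(1) by simp
    ultimately show ?thesis using Kn by (simp add: algebra_simps)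
  qed
  then show ?thesis using C1(1) C2(1) Kn by (intro exI[of _ "C1 + C2 + (\<Sum>i\<in>UNIV. K i)"]) auto
qed

end

section \<open>The noisy primal-dual iteration\<close>

lemma power2_norm_add_le: "(norm (a + b))\<^sup>2 \<le> 2 * (norm a)\<^sup>2 + 2 * (norm (b :: 'a::real_inner))\<^sup>2"
proof -
  have "(norm (a + b))\<^sup>2 + (norm (a - b))\<^sup>2 = 2 * (norm a)\<^sup>2 + 2 * (norm b)\<^sup>2"
    by (simp add: power2_norm_eq_inner inner_simps inner_commute)
  then show ?thesis using zero_le_power2[of "norm (a - b)"] by linarith
qed

lemma norm_snd_le_norm: "norm (snd z) \<le> norm (z :: 'a::real_normed_vector \<times> 'b::real_normed_vector)"
  using norm_snd_le[of "snd z" "fst z"] by simp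

lemma norm_fst_le_norm: "norm (fst z) \<le> norm (z :: 'a::real_normed_vector \<times> 'b::real_normed_vector)"
  using norm_fst_le[of "fst z" "snd z"] by simp

text \<open>The pairs of iterates and multipliers are the states \<open>Z k\<close>. Independence, zero mean and bounded
  variance are what the convergence proof uses of the noise. The last component of the noise enters
  with a minus sign because the operator contains \<open>- g\<close>.\<close>

locale noisy_saddle_iteration = convex_program X f g xhat muhat + prob_space P
  for X :: "(real^'n::finite) set" and f :: "'n \<Rightarrow> real \<Rightarrow> real"
    and g :: "real^'n \<Rightarrow> real^'m::finite" and xhat muhat and P :: "'w measure" +
  fixes N :: "'n option \<times> nat \<Rightarrow> 'w \<Rightarrow> real^'m" and V :: real
    and \<gamma> \<alpha> :: "nat \<Rightarrow> real" and \<alpha>max :: real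
    and z1 :: "(real^'n) \<times> (real^'m)" and Z :: "nat \<Rightarrow> 'w \<Rightarrow> (real^'n) \<times> (real^'m)"
  assumes indep: "indep_vars (\<lambda>_. borel) N UNIV"
    and mean: "\<And>\<iota> j. integrable P (\<lambda>\<omega>. N \<iota> \<omega> $ j)" "\<And>\<iota> j. expectation (\<lambda>\<omega>. N \<iota> \<omega> $ j) = 0"
    and variance: "\<And>\<iota>. integrable P (\<lambda>\<omega>. (norm (N \<iota> \<omega>))\<^sup>2)" "\<And>\<iota>. expectation (\<lambda>\<omega>. (norm (N \<iota> \<omega>))\<^sup>2) \<le> V"
    and \<gamma>: "\<And>k. k \<ge> 1 \<Longrightarrow> 0 < \<gamma> k"
    and \<alpha>: "\<And>k. k \<ge> 1 \<Longrightarrow> 0 < \<alpha> k" "\<And>k. k \<ge> 1 \<Longrightarrow> \<alpha> k \<le> \<alpha>max"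
    and Z1: "\<And>\<omega>. \<omega> \<in> space P \<Longrightarrow> Z 1 \<omega> = z1" and z1: "fst z1 \<in> X"
    and Z_Suc: "\<And>\<omega> k. \<omega> \<in> space P \<Longrightarrow> k \<ge> 1 \<Longrightarrow> Z (Suc k) \<omega> =
      map_prod (closest_point X) (closest_point nonneg_orthant)
        (Z k \<omega> - \<gamma> k *\<^sub>R (saddle_op (Z k \<omega>) + \<alpha> k *\<^sub>R Z k \<omega>
          + ((\<chi> i. N (Some i, k) \<omega> \<bullet> snd (Z k \<omega>)), - N (None, k) \<omega>)))"
begin

abbreviation S :: "((real^'n) \<times> (real^'m)) set" where "S \<equiv> X \<times> nonneg_orthant"

definition proj :: "(real^'n) \<times> (real^'m) \<Rightarrow> (real^'n) \<times> (real^'m)" where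
  "proj = map_prod (closest_point X) (closest_point nonneg_orthant)"

definition xi :: "nat \<Rightarrow> 'w \<Rightarrow> (real^'n) \<times> (real^'m)" where
  "xi k \<omega> = ((\<chi> i. N (Some i, k) \<omega> \<bullet> snd (Z k \<omega>)), - N (None, k) \<omega>)"

definition H :: "nat \<Rightarrow> 'w \<Rightarrow> (real^'n) \<times> (real^'m)" where
  "H k \<omega> = saddle_op (Z k \<omega>) + \<alpha> k *\<^sub>R Z k \<omega>"

lemma Z_step: "\<omega> \<in> space P \<Longrightarrow> k \<ge> 1 \<Longrightarrow> Z (Suc k) \<omega> = proj (Z k \<omega> - \<gamma> k *\<^sub>R (H k \<omega> + xi k \<omega>))"
  by (simp add: Z_Suc proj_def xi_def H_def)

lemma closed_X: "closed X" using X(2) by (rule compact_imp_closed)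

lemma nonneg_orthant_nonempty: "(nonneg_orthant :: (real^'m) set) \<noteq> {}"
  using zero_in_nonneg_orthant by blast

lemma proj_in: "proj z \<in> S"
  by (cases z) (simp add: proj_def closest_point_in_set closed_X X closed_nonneg_orthant nonneg_orthant_nonempty)

lemma proj_id: "z \<in> S \<Longrightarrow> proj z = z"
  by (cases z) (simp add: proj_def closest_point_self)

lemma proj_nonexpansive: "norm (proj u - proj v) \<le> norm (u - v)"
proof -
  have "norm (closest_point X (fst u) - closest_point X (fst v)) \<le> norm (fst (u - v))"
    using closest_point_lipschitz[OF X(3) closed_X X(1), of "fst u" "fst v"] by (simp add: dist_norm)
  moreover have "norm (closest_point nonneg_orthant (snd u) - closest_point nonneg_orthant (snd v)) \<le> norm (snd (u - v))"
    using closest_point_lipschitz[OF convex_nonneg_orthant closed_nonneg_orthant nonneg_orthant_nonempty,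
        of "snd u" "snd v"] by (simp add: dist_norm)
  ultimately show ?thesis
    unfolding norm_prod_def by (intro real_sqrt_le_mono add_mono power_mono) (simp_all add: proj_def)
qed

lemma borel_measurable_proj [measurable]: "proj \<in> borel_measurable borel"
proof -
  have "1-lipschitz_on UNIV proj"
    by (rule lipschitz_onI) (simp_all add: dist_norm proj_nonexpansive)
  then show ?thesis
    by (intro borel_measurable_continuous_onI lipschitz_on_continuous_on)
qed

lemma borel_measurable_saddle_op [measurable]: "saddle_op \<in> borel_measurable borel"
  by (intro borel_measurable_continuous_onI continuous_saddle_op)

lemma borel_measurable_noise [measurable]: "N \<iota> \<in> borel_measurable P"
  using indep unfolding indep_vars_def by blast

lemma fst_Z_in: "k \<ge> 1 \<Longrightarrow> \<omega> \<in> space P \<Longrightarrow> fst (Z k \<omega>) \<in> X"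
proof (induction k rule: dec_induct)
  case (step k)
  then show ?case using proj_in[of "Z k \<omega> - \<gamma> k *\<^sub>R (H k \<omega> + xi k \<omega>)"] by (simp add: Z_step mem_Times_iff)
qed (use Z1 z1 in simp)

text \<open>The initial multiplier may have negative entries, whereas the operator is monotone only over the
  nonnegative orthant. All estimates that use monotonicity therefore start at time \<open>2\<close>.\<close>

lemma Z_in: "k \<ge> 2 \<Longrightarrow> \<omega> \<in> space P \<Longrightarrow> Z k \<omega> \<in> S"
  using Z_step[of \<omega> "k - 1"] proj_in by simp

text \<open>The state at time \<open>k\<close> is a function of the noise before time \<open>k\<close>; this makes it independent
  of the noise at time \<open>k\<close>.\<close>

lemma Z_adapted:
  assumes "k \<ge> 1"
  shows "\<exists>\<Phi>. \<Phi> \<in> borel_measurable (PiM (UNIV \<times> {..<k}) (\<lambda>_. borel)) \<and>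
    (\<forall>\<omega>\<in>space P. Z k \<omega> = \<Phi> (\<lambda>\<iota>\<in>UNIV \<times> {..<k}. N \<iota> \<omega>))"
  using assms
proof (induction k rule: dec_induct)
  case base
  show ?case by (rule exI[of _ "\<lambda>_. z1"]) (use Z1 in simp)
next
  case (step k)
  then obtain \<Phi> where \<Phi> [measurable]: "\<Phi> \<in> borel_measurable (PiM (UNIV \<times> {..<k}) (\<lambda>_. borel))"
    and Z: "\<And>\<omega>. \<omega> \<in> space P \<Longrightarrow> Z k \<omega> = \<Phi> (\<lambda>\<iota>\<in>UNIV \<times> {..<k}. N \<iota> \<omega>)" by blast
  let ?B = "PiM (UNIV \<times> {..<Suc k}) (\<lambda>_. borel) :: ('n option \<times> nat \<Rightarrow> real^'m) measure"
  define R where "R = (\<lambda>\<nu> :: 'n option \<times> nat \<Rightarrow> real^'m. \<Phi> (restrict \<nu> (UNIV \<times> {..<k})))"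
  have [measurable]: "R \<in> borel_measurable ?B"
    unfolding R_def by (rule measurable_compose[OF measurable_restrict_subset \<Phi>]) auto
  have [measurable]: "(\<lambda>\<nu>. snd (R \<nu>)) \<in> borel_measurable ?B"
    by (rule borel_measurable_continuous_on[of snd]) (auto intro: continuous_intros)
  have [measurable]: "(\<lambda>\<nu>. \<nu> (\<iota>, k)) \<in> borel_measurable ?B" for \<iota>
    by (rule measurable_component_singleton) simp
  define \<Psi> where "\<Psi> = (\<lambda>\<nu>. proj (R \<nu> - \<gamma> k *\<^sub>R (saddle_op (R \<nu>) + \<alpha> k *\<^sub>R R \<nu>
      + ((\<chi> i. \<nu> (Some i, k) \<bullet> snd (R \<nu>)), - \<nu> (None, k)))))"
  have "\<Psi> \<in> borel_measurable ?B" unfolding \<Psi>_def by measurable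
  moreover have "Z (Suc k) \<omega> = \<Psi> (\<lambda>\<iota>\<in>UNIV \<times> {..<Suc k}. N \<iota> \<omega>)" if "\<omega> \<in> space P" for \<omega>
  proof -
    have "R (\<lambda>\<iota>\<in>UNIV \<times> {..<Suc k}. N \<iota> \<omega>) = Z k \<omega>"
      unfolding R_def Z[OF that] by (intro arg_cong[where f = \<Phi>]) (auto simp: restrict_def)
    then show ?thesis
      using that step(1) by (simp add: \<Psi>_def Z_step H_def xi_def)
  qed
  ultimately show ?case by blast
qed

lemma borel_measurable_Z [measurable]: "k \<ge> 1 \<Longrightarrow> Z k \<in> borel_measurable P"
proof -
  assume "k \<ge> 1"
  then obtain \<Phi> where \<Phi>: "\<Phi> \<in> borel_measurable (PiM (UNIV \<times> {..<k}) (\<lambda>_. borel))"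
    and Z: "\<And>\<omega>. \<omega> \<in> space P \<Longrightarrow> Z k \<omega> = \<Phi> (\<lambda>\<iota>\<in>UNIV \<times> {..<k}. N \<iota> \<omega>)"
    using Z_adapted by blast
  have "(\<lambda>\<omega>. \<Phi> (\<lambda>\<iota>\<in>UNIV \<times> {..<k}. N \<iota> \<omega>)) \<in> borel_measurable P"
    by (rule measurable_compose[OF measurable_restrict \<Phi>]) measurable
  then show ?thesis by (subst measurable_cong[OF Z]) auto
qed

lemma
  fixes u :: "real^'m \<Rightarrow> real" and q :: "(real^'n) \<times> (real^'m) \<Rightarrow> real"
  assumes k: "k \<ge> 1" and u: "u \<in> borel_measurable borel" and q: "q \<in> borel_measurable borel"
    and int: "integrable P (\<lambda>\<omega>. u (N (\<iota>, k) \<omega>))" "integrable P (\<lambda>\<omega>. q (Z k \<omega>))"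
  shows integrable_noise_mult: "integrable P (\<lambda>\<omega>. u (N (\<iota>, k) \<omega>) * q (Z k \<omega>))"
    and expectation_noise_mult: "expectation (\<lambda>\<omega>. u (N (\<iota>, k) \<omega>) * q (Z k \<omega>))
      = expectation (\<lambda>\<omega>. u (N (\<iota>, k) \<omega>)) * expectation (\<lambda>\<omega>. q (Z k \<omega>))"
proof -
  obtain \<Phi> where \<Phi>: "\<Phi> \<in> borel_measurable (PiM (UNIV \<times> {..<k}) (\<lambda>_. borel))"
    and Z: "\<And>\<omega>. \<omega> \<in> space P \<Longrightarrow> Z k \<omega> = \<Phi> (\<lambda>\<iota>\<in>UNIV \<times> {..<k}. N \<iota> \<omega>)"
    using Z_adapted[OF k] by blast
  define U where "U = (\<lambda>\<omega>. u (N (\<iota>, k) \<omega>))"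
  define Q where "Q = (\<lambda>\<omega>. q (\<Phi> (\<lambda>\<iota>\<in>UNIV \<times> {..<k}. N \<iota> \<omega>)))"
  have u': "(\<lambda>\<nu>. u (\<nu> (\<iota>, k))) \<in> borel_measurable (PiM {(\<iota>, k)} (\<lambda>_. borel))"
    by (rule measurable_compose[OF _ u]) (rule measurable_component_singleton, simp)
  have "indep_var borel ((\<lambda>\<nu>. u (\<nu> (\<iota>, k))) \<circ> (\<lambda>\<omega>. \<lambda>\<iota>\<in>{(\<iota>, k)}. N \<iota> \<omega>))
      borel ((q \<circ> \<Phi>) \<circ> (\<lambda>\<omega>. \<lambda>\<iota>\<in>UNIV \<times> {..<k}. N \<iota> \<omega>))"
    by (rule indep_var_compose[OF indep_var_restrict[OF indep]])
      (auto intro: measurable_comp[OF \<Phi> q] u')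
  then have ind: "indep_var borel U borel Q" by (simp add: U_def Q_def o_def)
  have intU: "integrable P U" using int(1) by (simp add: U_def)
  have "integrable P Q \<longleftrightarrow> integrable P (\<lambda>\<omega>. q (Z k \<omega>))"
    by (rule Bochner_Integration.integrable_cong[OF refl]) (simp_all add: Q_def Z)
  then have intQ: "integrable P Q" using int(2) by simp
  have "integrable P (\<lambda>\<omega>. U \<omega> * Q \<omega>) \<longleftrightarrow> integrable P (\<lambda>\<omega>. u (N (\<iota>, k) \<omega>) * q (Z k \<omega>))"
    by (rule Bochner_Integration.integrable_cong[OF refl]) (simp_all add: Q_def U_def Z)
  then show "integrable P (\<lambda>\<omega>. u (N (\<iota>, k) \<omega>) * q (Z k \<omega>))"
    using indep_var_integrable[OF ind intU intQ] by simp
  have "expectation (\<lambda>\<omega>. U \<omega> * Q \<omega>) = expectation (\<lambda>\<omega>. u (N (\<iota>, k) \<omega>) * q (Z k \<omega>))"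
    by (rule Bochner_Integration.integral_cong) (simp_all add: Q_def U_def Z)
  moreover have "expectation Q = expectation (\<lambda>\<omega>. q (Z k \<omega>))"
    by (rule Bochner_Integration.integral_cong) (simp_all add: Q_def Z)
  ultimately show "expectation (\<lambda>\<omega>. u (N (\<iota>, k) \<omega>) * q (Z k \<omega>))
      = expectation (\<lambda>\<omega>. u (N (\<iota>, k) \<omega>)) * expectation (\<lambda>\<omega>. q (Z k \<omega>))"
    using indep_var_lebesgue_integral[OF ind intU intQ] by (simp add: U_def)
qed

lemma V_nonneg: "0 \<le> V"
  using variance(2)[of undefined] by (rule order_trans[rotated]) simp

text \<open>The noise on the Jacobian is multiplied by the multiplier, so its variance is not bounded but grows
  with the square of the state.\<close>

lemma power2_norm_xi_le:
  "(norm (xi k \<omega>))\<^sup>2 \<le> (\<Sum>i\<in>UNIV. (norm (N (Some i, k) \<omega>))\<^sup>2 * (norm (Z k \<omega>))\<^sup>2) + (norm (N (None, k) \<omega>))\<^sup>2"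
proof -
  have "(norm (\<chi> i. N (Some i, k) \<omega> \<bullet> snd (Z k \<omega>)))\<^sup>2 = (\<Sum>i\<in>UNIV. (N (Some i, k) \<omega> \<bullet> snd (Z k \<omega>))\<^sup>2)"
    by (simp add: norm_vec_def L2_set_def sum_nonneg)
  also have "\<dots> \<le> (\<Sum>i\<in>UNIV. (norm (N (Some i, k) \<omega>))\<^sup>2 * (norm (Z k \<omega>))\<^sup>2)"
  proof (rule sum_mono)
    fix i
    have "\<bar>N (Some i, k) \<omega> \<bullet> snd (Z k \<omega>)\<bar> \<le> norm (N (Some i, k) \<omega>) * norm (Z k \<omega>)"
      by (rule order_trans[OF Cauchy_Schwarz_ineq2 mult_left_mono]) (simp_all add: norm_snd_le_norm)
    then show "(N (Some i, k) \<omega> \<bullet> snd (Z k \<omega>))\<^sup>2 \<le> (norm (N (Some i, k) \<omega>))\<^sup>2 * (norm (Z k \<omega>))\<^sup>2"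
      using power_mono[OF _ abs_ge_zero, of _ _ 2] by (fastforce simp flip: power_mult_distrib)
  qed
  finally show ?thesis by (simp add: xi_def norm_prod_def)
qed

lemma power2_norm_H_le:
  obtains C where "C > 0"
    "\<And>k \<omega>. k \<ge> 1 \<Longrightarrow> \<omega> \<in> space P \<Longrightarrow> (norm (H k \<omega>))\<^sup>2 \<le> C * (1 + (norm (Z k \<omega>))\<^sup>2)"
proof -
  obtain K where K: "K > 0" "\<And>z. fst z \<in> X \<Longrightarrow> norm (saddle_op z) \<le> K * (1 + norm (snd z))"
    using saddle_op_linear_growth by blast
  have am: "0 < \<alpha>max" using \<alpha>[of 1] by simp
  show ?thesis
  proof (rule that)
    show "0 < 2 * (K + \<alpha>max)\<^sup>2" using K(1) am by simp
    fix k \<omega> assume k: "k \<ge> (1::nat)" and \<omega>: "\<omega> \<in> space P"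
    have "norm (H k \<omega>) \<le> K * (1 + norm (snd (Z k \<omega>))) + \<alpha> k * norm (Z k \<omega>)"
      unfolding H_def using K(2)[OF fst_Z_in[OF k \<omega>]] \<alpha>(1)[OF k]
      by (intro order_trans[OF norm_triangle_ineq]) simp
    also have "\<dots> \<le> K * (1 + norm (Z k \<omega>)) + \<alpha>max * (1 + norm (Z k \<omega>))"
      using K(1) am \<alpha>[OF k] by (intro add_mono mult_mono) (auto simp: norm_snd_le_norm)
    finally have "norm (H k \<omega>) \<le> (K + \<alpha>max) * (1 + norm (Z k \<omega>))" by (simp add: algebra_simps)
    then have "(norm (H k \<omega>))\<^sup>2 \<le> (K + \<alpha>max)\<^sup>2 * (1 + norm (Z k \<omega>))\<^sup>2"
      using power_mono[OF _ norm_ge_zero, of _ _ 2] by (fastforce simp flip: power_mult_distrib)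
    also have "\<dots> \<le> (K + \<alpha>max)\<^sup>2 * (2 * (1 + (norm (Z k \<omega>))\<^sup>2))"
      using power2_norm_add_le[of 1 "norm (Z k \<omega>)"] by (intro mult_left_mono) simp_all
    finally show "(norm (H k \<omega>))\<^sup>2 \<le> 2 * (K + \<alpha>max)\<^sup>2 * (1 + (norm (Z k \<omega>))\<^sup>2)"
      by (simp only: mult_ac)
  qed
qed

lemma
  assumes k: "k \<ge> 1" and int: "integrable P (\<lambda>\<omega>. (norm (Z k \<omega>))\<^sup>2)"
  shows integrable_norm_xi: "integrable P (\<lambda>\<omega>. (norm (xi k \<omega>))\<^sup>2)"
    and expectation_norm_xi_le: "expectation (\<lambda>\<omega>. (norm (xi k \<omega>))\<^sup>2)
      \<le> V * CARD('n) * expectation (\<lambda>\<omega>. (norm (Z k \<omega>))\<^sup>2) + V"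
proof -
  let ?R = "\<lambda>\<omega>. (\<Sum>i\<in>UNIV. (norm (N (Some i, k) \<omega>))\<^sup>2 * (norm (Z k \<omega>))\<^sup>2) + (norm (N (None, k) \<omega>))\<^sup>2"
  have [measurable]: "Z k \<in> borel_measurable P" using k by measurable
  have prod: "integrable P (\<lambda>\<omega>. (norm (N (\<iota>, k) \<omega>))\<^sup>2 * (norm (Z k \<omega>))\<^sup>2)"
    "expectation (\<lambda>\<omega>. (norm (N (\<iota>, k) \<omega>))\<^sup>2 * (norm (Z k \<omega>))\<^sup>2)
      = expectation (\<lambda>\<omega>. (norm (N (\<iota>, k) \<omega>))\<^sup>2) * expectation (\<lambda>\<omega>. (norm (Z k \<omega>))\<^sup>2)" for \<iota>
    using integrable_noise_mult[OF k _ _ variance(1) int] expectation_noise_mult[OF k _ _ variance(1) int] by auto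
  have intR: "integrable P ?R" by (intro Bochner_Integration.integrable_add Bochner_Integration.integrable_sum prod(1) variance(1))
  have "(\<lambda>\<omega>. xi k \<omega>) \<in> borel_measurable P"
    unfolding xi_def by (intro borel_measurable_Pair borel_measurable_vec_lambda borel_measurable_inner
        borel_measurable_uminus borel_measurable_noise borel_measurable_continuous_on[of snd])
      (auto intro: continuous_intros)
  then show ix: "integrable P (\<lambda>\<omega>. (norm (xi k \<omega>))\<^sup>2)"
    using intR by (rule_tac Bochner_Integration.integrable_bound)
      (auto intro!: power2_norm_xi_le abs_ge_self[THEN order_trans[rotated]])
  have "expectation (\<lambda>\<omega>. (norm (xi k \<omega>))\<^sup>2) \<le> expectation ?R"
    using ix intR power2_norm_xi_le by (rule integral_mono)
  also have "\<dots> = (\<Sum>i\<in>UNIV. expectation (\<lambda>\<omega>. (norm (N (Some i, k) \<omega>))\<^sup>2) * expectation (\<lambda>\<omega>. (norm (Z k \<omega>))\<^sup>2))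
      + expectation (\<lambda>\<omega>. (norm (N (None, k) \<omega>))\<^sup>2)"
    by (subst Bochner_Integration.integral_add)
      (auto simp: prod intro!: Bochner_Integration.integrable_sum variance(1))
  also have "\<dots> \<le> (\<Sum>i\<in>(UNIV::'n set). V * expectation (\<lambda>\<omega>. (norm (Z k \<omega>))\<^sup>2)) + V"
    by (intro add_mono sum_mono mult_right_mono variance(2)) auto
  finally show "expectation (\<lambda>\<omega>. (norm (xi k \<omega>))\<^sup>2)
      \<le> V * CARD('n) * expectation (\<lambda>\<omega>. (norm (Z k \<omega>))\<^sup>2) + V" by (simp add: mult_ac)
qed

lemma integrable_norm_Z: "k \<ge> 1 \<Longrightarrow> integrable P (\<lambda>\<omega>. (norm (Z k \<omega>))\<^sup>2)"
proof (induction k rule: dec_induct)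
  case base
  have "integrable P (\<lambda>\<omega>. (norm (Z 1 \<omega>))\<^sup>2) \<longleftrightarrow> integrable P (\<lambda>_. (norm z1)\<^sup>2)"
    by (rule Bochner_Integration.integrable_cong[OF refl]) (simp_all add: Z1[unfolded One_nat_def])
  then show ?case by simp
next
  case (step k)
  obtain C where C: "C > 0"
    "\<And>k \<omega>. k \<ge> 1 \<Longrightarrow> \<omega> \<in> space P \<Longrightarrow> (norm (H k \<omega>))\<^sup>2 \<le> C * (1 + (norm (Z k \<omega>))\<^sup>2)"
    using power2_norm_H_le by blast
  define zh where "zh = (xhat, muhat)"
  have zh: "zh \<in> S" unfolding zh_def by (rule saddle.zh)
  have bound: "(norm (Z (Suc k) \<omega>))\<^sup>2 \<le> 8 * (norm (Z k \<omega>))\<^sup>2 + 10 * (norm zh)\<^sup>2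
      + 8 * (\<gamma> k)\<^sup>2 * (C * (1 + (norm (Z k \<omega>))\<^sup>2) + (norm (xi k \<omega>))\<^sup>2)" if \<omega>: "\<omega> \<in> space P" for \<omega>
  proof -
    let ?d = "\<gamma> k *\<^sub>R (H k \<omega> + xi k \<omega>)"
    have "norm (Z (Suc k) \<omega> - zh) \<le> norm (Z k \<omega> - ?d - zh)"
      using proj_nonexpansive[of "Z k \<omega> - ?d" zh] proj_id[OF zh] by (simp add: Z_step[OF \<omega> step(1)])
    then have "(norm (Z (Suc k) \<omega> - zh))\<^sup>2 \<le> (norm ((Z k \<omega> + - zh) + - ?d))\<^sup>2"
      by (intro power_mono) (simp_all add: algebra_simps)
    also have "\<dots> \<le> 2 * (norm (Z k \<omega> + - zh))\<^sup>2 + 2 * (norm ?d)\<^sup>2"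
      using power2_norm_add_le[of "Z k \<omega> + - zh" "- ?d"] by simp
    finally have 1: "(norm (Z (Suc k) \<omega> - zh))\<^sup>2 \<le> 2 * (norm (Z k \<omega> + - zh))\<^sup>2 + 2 * (norm ?d)\<^sup>2" .
    have 2: "(norm (Z k \<omega> + - zh))\<^sup>2 \<le> 2 * (norm (Z k \<omega>))\<^sup>2 + 2 * (norm zh)\<^sup>2"
      using power2_norm_add_le[of "Z k \<omega>" "- zh"] by simp
    have 3: "(norm (Z (Suc k) \<omega>))\<^sup>2 \<le> 2 * (norm (Z (Suc k) \<omega> - zh))\<^sup>2 + 2 * (norm zh)\<^sup>2"
      using power2_norm_add_le[of "Z (Suc k) \<omega> - zh" zh] by simp
    have "(norm ?d)\<^sup>2 = (\<gamma> k)\<^sup>2 * (norm (H k \<omega> + xi k \<omega>))\<^sup>2" by (simp add: power_mult_distrib)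
    also have "\<dots> \<le> (\<gamma> k)\<^sup>2 * (2 * (C * (1 + (norm (Z k \<omega>))\<^sup>2)) + 2 * (norm (xi k \<omega>))\<^sup>2)"
      using C(2)[OF step(1) \<omega>] power2_norm_add_le[of "H k \<omega>" "xi k \<omega>"] by (intro mult_left_mono) auto
    finally have 4: "(norm ?d)\<^sup>2 \<le> 2 * ((\<gamma> k)\<^sup>2 * (C * (1 + (norm (Z k \<omega>))\<^sup>2) + (norm (xi k \<omega>))\<^sup>2))"
      by (simp add: algebra_simps)
    show ?thesis using 1 2 3 4 unfolding mult.assoc[of 8] by linarith
  qed
  have "integrable P (\<lambda>\<omega>. 8 * (norm (Z k \<omega>))\<^sup>2 + 10 * (norm zh)\<^sup>2
      + 8 * (\<gamma> k)\<^sup>2 * (C * (1 + (norm (Z k \<omega>))\<^sup>2) + (norm (xi k \<omega>))\<^sup>2))"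
    using step(3) integrable_norm_xi[OF step(1,3)]
    by (intro Bochner_Integration.integrable_add integrable_mult_right) auto
  moreover have "(\<lambda>\<omega>. (norm (Z (Suc k) \<omega>))\<^sup>2) \<in> borel_measurable P"
    using borel_measurable_Z[of "Suc k"] by measurable
  ultimately show ?case
    by (rule Bochner_Integration.integrable_bound)
      (auto intro!: AE_I2 bound abs_ge_self[THEN order_trans[rotated]])
qed

lemma integrable_norm_Z_diff:
  assumes "k \<ge> 1" shows "integrable P (\<lambda>\<omega>. (norm (Z k \<omega> - t))\<^sup>2)"
proof (rule Bochner_Integration.integrable_bound)
  show "integrable P (\<lambda>\<omega>. 2 * (norm (Z k \<omega>))\<^sup>2 + 2 * (norm t)\<^sup>2)"
    using integrable_norm_Z[OF assms] by simp
  show "(\<lambda>\<omega>. (norm (Z k \<omega> - t))\<^sup>2) \<in> borel_measurable P"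
    using borel_measurable_Z[OF assms] by measurable
  show "AE \<omega> in P. norm ((norm (Z k \<omega> - t))\<^sup>2) \<le> norm (2 * (norm (Z k \<omega>))\<^sup>2 + 2 * (norm t)\<^sup>2)"
    using power2_norm_add_le[of "Z k \<omega>" "- t" for \<omega>] by (intro AE_I2) simp
qed

lemma
  assumes k: "k \<ge> 1"
  shows integrable_xi_inner: "integrable P (\<lambda>\<omega>. xi k \<omega> \<bullet> (Z k \<omega> - t))"
    and expectation_xi_inner: "expectation (\<lambda>\<omega>. xi k \<omega> \<bullet> (Z k \<omega> - t)) = 0"
proof -
  note [measurable] = borel_measurable_Z[OF k]
  define q where "q = (\<lambda>i j z. snd z $ j * fst (z - t) $ i)"
  define r where "r = (\<lambda>j z. snd (z - t) $ j)"
  have qm: "q i j \<in> borel_measurable borel" for i j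
    unfolding q_def by (intro borel_measurable_continuous_onI continuous_intros)
  have rm: "r j \<in> borel_measurable borel" for j
    unfolding r_def by (intro borel_measurable_continuous_onI continuous_intros)
  have nth_le: "\<bar>fst z $ i\<bar> \<le> norm z" "\<bar>snd z $ j\<bar> \<le> norm z" for z :: "(real^'n) \<times> (real^'m)" and i j
    using component_le_norm_cart[of "fst z" i] component_le_norm_cart[of "snd z" j]
      norm_fst_le_norm[of z] norm_snd_le_norm[of z] by linarith+
  have qi: "integrable P (\<lambda>\<omega>. q i j (Z k \<omega>))" for i j
  proof (rule Bochner_Integration.integrable_bound)
    show "integrable P (\<lambda>\<omega>. (norm (Z k \<omega>))\<^sup>2 + (norm (Z k \<omega> - t))\<^sup>2)"
      using integrable_norm_Z[OF k] integrable_norm_Z_diff[OF k] by simp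
    show "(\<lambda>\<omega>. q i j (Z k \<omega>)) \<in> borel_measurable P" using qm by measurable
    have "norm (q i j z) \<le> norm ((norm z)\<^sup>2 + (norm (z - t))\<^sup>2)" for z
    proof -
      have "norm (q i j z) \<le> norm z * norm (z - t)"
        using nth_le[of z] nth_le[of "z - t"] unfolding q_def real_norm_def abs_mult
        by (intro mult_mono) auto
      also have "\<dots> \<le> (norm z)\<^sup>2 + (norm (z - t))\<^sup>2"
        using sum_squares_bound[of "norm z" "norm (z - t)"]
          mult_nonneg_nonneg[OF norm_ge_zero norm_ge_zero, of z "z - t"] by linarith
      finally show ?thesis by simp
    qed
    then show "AE \<omega> in P. norm (q i j (Z k \<omega>)) \<le> norm ((norm (Z k \<omega>))\<^sup>2 + (norm (Z k \<omega> - t))\<^sup>2)"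
      by simp
  qed
  have ri: "integrable P (\<lambda>\<omega>. r j (Z k \<omega>))" for j
  proof (rule Bochner_Integration.integrable_bound)
    show "integrable P (\<lambda>\<omega>. 1 + (norm (Z k \<omega> - t))\<^sup>2)"
      using integrable_norm_Z_diff[OF k] by simp
    show "(\<lambda>\<omega>. r j (Z k \<omega>)) \<in> borel_measurable P" using rm by measurable
    have "norm (r j z) \<le> norm (1 + (norm (z - t))\<^sup>2)" for z
      using nth_le(2)[of "z - t" j] sum_squares_bound[of 1 "norm (z - t)"] unfolding r_def
      by simp
    then show "AE \<omega> in P. norm (r j (Z k \<omega>)) \<le> norm (1 + (norm (Z k \<omega> - t))\<^sup>2)" by simp
  qed
  have eq: "xi k \<omega> \<bullet> (Z k \<omega> - t) = (\<Sum>i\<in>UNIV. \<Sum>j\<in>UNIV. N (Some i, k) \<omega> $ j * q i j (Z k \<omega>))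
      - (\<Sum>j\<in>UNIV. N (None, k) \<omega> $ j * r j (Z k \<omega>))" for \<omega>
    by (simp add: xi_def q_def r_def inner_prod_def inner_vec_def sum_distrib_left sum_distrib_right sum_negf mult_ac)
  have nm: "(\<lambda>v::real^'m. v $ j) \<in> borel_measurable borel" for j by simp
  note Q = integrable_noise_mult[OF k nm qm mean(1) qi] expectation_noise_mult[OF k nm qm mean(1) qi]
  note R = integrable_noise_mult[OF k nm rm mean(1) ri] expectation_noise_mult[OF k nm rm mean(1) ri]
  show "integrable P (\<lambda>\<omega>. xi k \<omega> \<bullet> (Z k \<omega> - t))"
    unfolding eq by (intro Bochner_Integration.integrable_diff Bochner_Integration.integrable_sum Q(1) R(1))
  show "expectation (\<lambda>\<omega>. xi k \<omega> \<bullet> (Z k \<omega> - t)) = 0"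
    unfolding eq using Q R by (simp add: mean(2))
qed

text \<open>The distance is taken to the current regularized solution, not to the saddle point, because the
  step contracts towards the former.\<close>

definition err :: "nat \<Rightarrow> real" where
  "err k = expectation (\<lambda>\<omega>. (norm (Z k \<omega> - saddle.tik (\<alpha> k)))\<^sup>2)"

text \<open>The projection is nonexpansive and fixes the regularized solution, so the square can be expanded
  before projecting. Strong monotonicity gives the contraction \<open>2 * \<gamma> k * \<alpha> k\<close>, the noise term that is
  linear in \<open>\<gamma> k\<close> has mean zero, and everything quadratic in \<open>\<gamma> k\<close> is at most a multiple of
  \<open>err k + 1\<close>.\<close>

lemma one_step:
  obtains C where "C > 0" "\<And>k. k \<ge> 2 \<Longrightarrow>
    expectation (\<lambda>\<omega>. (norm (Z (Suc k) \<omega> - saddle.tik (\<alpha> k)))\<^sup>2)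
      \<le> (1 - 2 * \<gamma> k * \<alpha> k + C * (\<gamma> k)\<^sup>2) * err k + C * (\<gamma> k)\<^sup>2"
proof -
  obtain C0 where C0: "C0 > 0"
    "\<And>k \<omega>. k \<ge> 1 \<Longrightarrow> \<omega> \<in> space P \<Longrightarrow> (norm (H k \<omega>))\<^sup>2 \<le> C0 * (1 + (norm (Z k \<omega>))\<^sup>2)"
    using power2_norm_H_le by blast
  define zh where "zh = (xhat, muhat)"
  define c where "c = C0 + V * CARD('n)"
  have c: "0 < c" using C0(1) V_nonneg by (simp add: c_def add_pos_nonneg)
  define C where "C = 4 * c + 2 * (C0 + V) + 4 * c * (norm zh)\<^sup>2"
  have "0 < C" using c C0(1) V_nonneg by (simp add: C_def add_pos_nonneg)
  moreover have "expectation (\<lambda>\<omega>. (norm (Z (Suc k) \<omega> - saddle.tik (\<alpha> k)))\<^sup>2)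
      \<le> (1 - 2 * \<gamma> k * \<alpha> k + C * (\<gamma> k)\<^sup>2) * err k + C * (\<gamma> k)\<^sup>2" if k2: "k \<ge> 2" for k
  proof -
    have k: "k \<ge> 1" using k2 by simp
    define t where "t = saddle.tik (\<alpha> k)"
    have tS: "t \<in> S" unfolding t_def by (rule saddle.tik_in[OF \<alpha>(1)[OF k]])
    have tn: "norm t \<le> norm zh" unfolding t_def zh_def by (rule saddle.norm_tik_le[OF \<alpha>(1)[OF k]])
    note iZ = integrable_norm_Z[OF k] and iD = integrable_norm_Z_diff[OF k, of t]
      and iX = integrable_norm_xi[OF k integrable_norm_Z[OF k]] and iI = integrable_xi_inner[OF k, of t]
    let ?R = "\<lambda>\<omega>. (1 - 2 * \<gamma> k * \<alpha> k) * (norm (Z k \<omega> - t))\<^sup>2 - 2 * \<gamma> k * (xi k \<omega> \<bullet> (Z k \<omega> - t))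
      + (2 * (\<gamma> k)\<^sup>2 * (C0 * (1 + (norm (Z k \<omega>))\<^sup>2)) + 2 * (\<gamma> k)\<^sup>2 * (norm (xi k \<omega>))\<^sup>2)"
    have bound: "(norm (Z (Suc k) \<omega> - t))\<^sup>2 \<le> ?R \<omega>" if \<omega>: "\<omega> \<in> space P" for \<omega>
    proof -
      let ?d = "\<gamma> k *\<^sub>R (H k \<omega> + xi k \<omega>)"
      have "norm (Z (Suc k) \<omega> - t) \<le> norm (Z k \<omega> - ?d - t)"
        using proj_nonexpansive[of "Z k \<omega> - ?d" t] proj_id[OF tS] by (simp add: Z_step[OF \<omega> k])
      then have "(norm (Z (Suc k) \<omega> - t))\<^sup>2 \<le> (norm (Z k \<omega> - ?d - t))\<^sup>2" by (intro power_mono) auto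
      also have "\<dots> = (norm (Z k \<omega> - t))\<^sup>2 - 2 * \<gamma> k * (H k \<omega> \<bullet> (Z k \<omega> - t))
          - 2 * \<gamma> k * (xi k \<omega> \<bullet> (Z k \<omega> - t)) + (\<gamma> k)\<^sup>2 * (norm (H k \<omega> + xi k \<omega>))\<^sup>2"
      proof -
        have "(norm (d - r *\<^sub>R y))\<^sup>2 = (norm d)\<^sup>2 - 2 * r * (y \<bullet> d) + r\<^sup>2 * (norm y)\<^sup>2"
          for d y :: "(real^'n) \<times> (real^'m)" and r
          unfolding power2_norm_eq_inner
          by (simp add: inner_diff_left inner_diff_right inner_commute[of d y] power2_eq_square algebra_simps)
        from this[of "Z k \<omega> - t" "\<gamma> k" "H k \<omega> + xi k \<omega>"] show ?thesis
          by (simp add: inner_add_left distrib_left diff_diff_eq add.commute[of t] del: scaleR_add_right)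
      qed
      also have "\<dots> \<le> (norm (Z k \<omega> - t))\<^sup>2 - 2 * \<gamma> k * (\<alpha> k * (norm (Z k \<omega> - t))\<^sup>2)
          - 2 * \<gamma> k * (xi k \<omega> \<bullet> (Z k \<omega> - t))
          + (\<gamma> k)\<^sup>2 * (2 * (C0 * (1 + (norm (Z k \<omega>))\<^sup>2)) + 2 * (norm (xi k \<omega>))\<^sup>2)"
      proof (intro add_mono diff_mono mult_left_mono order_refl)
        show "\<alpha> k * (norm (Z k \<omega> - t))\<^sup>2 \<le> H k \<omega> \<bullet> (Z k \<omega> - t)"
          unfolding t_def H_def by (rule saddle.tik_strongly_monotone[OF \<alpha>(1)[OF k] Z_in[OF k2 \<omega>]])
        show "(norm (H k \<omega> + xi k \<omega>))\<^sup>2 \<le> 2 * (C0 * (1 + (norm (Z k \<omega>))\<^sup>2)) + 2 * (norm (xi k \<omega>))\<^sup>2"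
          using C0(2)[OF k \<omega>] power2_norm_add_le[of "H k \<omega>" "xi k \<omega>"] by linarith
      qed (use \<gamma>[OF k] in auto)
      also have "\<dots> = ?R \<omega>" by (simp add: algebra_simps)
      finally show ?thesis .
    qed
    have "expectation (\<lambda>\<omega>. (norm (Z (Suc k) \<omega> - t))\<^sup>2) \<le> expectation ?R"
    proof (rule integral_mono_AE)
      show "integrable P (\<lambda>\<omega>. (norm (Z (Suc k) \<omega> - t))\<^sup>2)" by (rule integrable_norm_Z_diff) simp
      show "integrable P ?R"
        by (intro Bochner_Integration.integrable_add Bochner_Integration.integrable_diff
            integrable_mult_right iZ iD iX iI) simp
    qed (use bound in simp)
    also have "\<dots> = (1 - 2 * \<gamma> k * \<alpha> k) * err k
        + (2 * (\<gamma> k)\<^sup>2 * (C0 * (1 + expectation (\<lambda>\<omega>. (norm (Z k \<omega>))\<^sup>2)))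
          + 2 * (\<gamma> k)\<^sup>2 * expectation (\<lambda>\<omega>. (norm (xi k \<omega>))\<^sup>2))"
      using iZ iD iX iI expectation_xi_inner[OF k, of t]
      by (simp add: err_def t_def prob_space)
    also have "\<dots> \<le> (1 - 2 * \<gamma> k * \<alpha> k) * err k
        + 2 * (\<gamma> k)\<^sup>2 * (c * expectation (\<lambda>\<omega>. (norm (Z k \<omega>))\<^sup>2) + C0 + V)"
    proof -
      have "2 * (\<gamma> k)\<^sup>2 * expectation (\<lambda>\<omega>. (norm (xi k \<omega>))\<^sup>2)
          \<le> 2 * (\<gamma> k)\<^sup>2 * (V * CARD('n) * expectation (\<lambda>\<omega>. (norm (Z k \<omega>))\<^sup>2) + V)"
        by (intro mult_left_mono expectation_norm_xi_le[OF k iZ]) simp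
      then show ?thesis by (simp add: c_def algebra_simps)
    qed
    also have "\<dots> \<le> (1 - 2 * \<gamma> k * \<alpha> k) * err k
        + 2 * (\<gamma> k)\<^sup>2 * (c * (2 * err k + 2 * (norm zh)\<^sup>2) + C0 + V)"
    proof -
      have "expectation (\<lambda>\<omega>. (norm (Z k \<omega>))\<^sup>2)
          \<le> expectation (\<lambda>\<omega>. 2 * (norm (Z k \<omega> - t))\<^sup>2 + 2 * (norm zh)\<^sup>2)"
      proof (rule integral_mono[OF iZ])
        show "integrable P (\<lambda>\<omega>. 2 * (norm (Z k \<omega> - t))\<^sup>2 + 2 * (norm zh)\<^sup>2)" using iD by simp
        show "(norm (Z k \<omega>))\<^sup>2 \<le> 2 * (norm (Z k \<omega> - t))\<^sup>2 + 2 * (norm zh)\<^sup>2" for \<omega>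
        proof -
          have "(norm (Z k \<omega>))\<^sup>2 \<le> 2 * (norm (Z k \<omega> - t))\<^sup>2 + 2 * (norm t)\<^sup>2"
            using power2_norm_add_le[of "Z k \<omega> - t" t] by simp
          with power_mono[OF tn norm_ge_zero, of 2] show ?thesis by linarith
        qed
      qed
      also have "\<dots> = 2 * err k + 2 * (norm zh)\<^sup>2"
        using iD by (simp add: err_def t_def prob_space)
      finally show ?thesis using c by (intro add_mono mult_left_mono order_refl) auto
    qed
    also have "\<dots> \<le> (1 - 2 * \<gamma> k * \<alpha> k + C * (\<gamma> k)\<^sup>2) * err k + C * (\<gamma> k)\<^sup>2"
    proof -
      have "0 \<le> err k" by (simp add: err_def)
      then have "4 * c * ((\<gamma> k)\<^sup>2 * err k) \<le> C * ((\<gamma> k)\<^sup>2 * err k)"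
        using c C0(1) V_nonneg by (intro mult_right_mono) (auto simp: C_def)
      moreover have "(2 * (C0 + V) + 4 * c * (norm zh)\<^sup>2) * (\<gamma> k)\<^sup>2 \<le> C * (\<gamma> k)\<^sup>2"
        using c by (intro mult_right_mono) (auto simp: C_def)
      ultimately show ?thesis by (simp add: algebra_simps)
    qed
    finally show ?thesis by (simp add: t_def)
  qed
  ultimately show ?thesis by (rule that)
qed

end

context noisy_saddle_iteration
begin

text \<open>The regularized solution moves between two steps. Young's inequality with a free weight \<open>\<eta>\<close> splits
  off this motion.\<close>

lemma err_Suc_le:
  assumes k: "k \<ge> 1" and \<eta>: "\<eta> > 0"
  shows "err (Suc k) \<le> (1 + \<eta>) * expectation (\<lambda>\<omega>. (norm (Z (Suc k) \<omega> - saddle.tik (\<alpha> k)))\<^sup>2)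
    + (1 + 1 / \<eta>) * (norm (saddle.tik (\<alpha> k) - saddle.tik (\<alpha> (Suc k))))\<^sup>2"
proof -
  define t where "t = saddle.tik (\<alpha> k)"
  define t' where "t' = saddle.tik (\<alpha> (Suc k))"
  have young: "(norm (u + v))\<^sup>2 \<le> (1 + \<eta>) * (norm u)\<^sup>2 + (1 + 1 / \<eta>) * (norm v)\<^sup>2"
    for u v :: "(real^'n) \<times> (real^'m)"
  proof -
    have "(norm (u + v))\<^sup>2 \<le> (norm u + norm v)\<^sup>2" by (intro power_mono norm_triangle_ineq) simp
    also have "\<dots> = (norm u)\<^sup>2 + 2 * norm u * norm v + (norm v)\<^sup>2" by (simp add: power2_sum)
    also have "2 * norm u * norm v \<le> \<eta> * (norm u)\<^sup>2 + (norm v)\<^sup>2 / \<eta>"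
      using sum_squares_bound[of "sqrt \<eta> * norm u" "norm v / sqrt \<eta>"] \<eta>
      by (simp add: power_mult_distrib power_divide)
    finally show ?thesis by (simp add: algebra_simps)
  qed
  have int: "integrable P (\<lambda>\<omega>. (norm (Z (Suc k) \<omega> - s))\<^sup>2)" for s
    by (rule integrable_norm_Z_diff) simp
  have "err (Suc k) \<le> expectation (\<lambda>\<omega>. (1 + \<eta>) * (norm (Z (Suc k) \<omega> - t))\<^sup>2 + (1 + 1 / \<eta>) * (norm (t - t'))\<^sup>2)"
    unfolding err_def t'_def[symmetric]
  proof (rule integral_mono[OF int])
    show "integrable P (\<lambda>\<omega>. (1 + \<eta>) * (norm (Z (Suc k) \<omega> - t))\<^sup>2 + (1 + 1 / \<eta>) * (norm (t - t'))\<^sup>2)"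
      using int[of t] by simp
    show "(norm (Z (Suc k) \<omega> - t'))\<^sup>2 \<le> (1 + \<eta>) * (norm (Z (Suc k) \<omega> - t))\<^sup>2 + (1 + 1 / \<eta>) * (norm (t - t'))\<^sup>2" for \<omega>
      using young[of "Z (Suc k) \<omega> - t" "t - t'"] by simp
  qed
  also have "\<dots> = (1 + \<eta>) * expectation (\<lambda>\<omega>. (norm (Z (Suc k) \<omega> - t))\<^sup>2) + (1 + 1 / \<eta>) * (norm (t - t'))\<^sup>2"
    using int[of t] by (simp add: prob_space)
  finally show ?thesis by (simp only: t_def t'_def)
qed

lemma err_tendsto_0:
  assumes \<gamma>\<alpha>: "(\<lambda>k. \<gamma> k / \<alpha> k) \<longlonglongrightarrow> 0" and prod: "(\<lambda>k. \<gamma> k * \<alpha> k) \<longlonglongrightarrow> 0"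
    and drift: "(\<lambda>k. \<bar>\<alpha> k - \<alpha> (Suc k)\<bar> / \<alpha> k / (\<gamma> k * \<alpha> k)) \<longlonglongrightarrow> 0"
    and div: "filterlim (\<lambda>n. \<Sum>k<n. \<gamma> k * \<alpha> k) at_top sequentially"
  shows "err \<longlonglongrightarrow> 0"
proof -
  obtain C where "C > 0" and C: "\<And>k. k \<ge> 2 \<Longrightarrow>
    expectation (\<lambda>\<omega>. (norm (Z (Suc k) \<omega> - saddle.tik (\<alpha> k)))\<^sup>2)
      \<le> (1 - 2 * \<gamma> k * \<alpha> k + C * (\<gamma> k)\<^sup>2) * err k + C * (\<gamma> k)\<^sup>2"
    using one_step by blast
  define c where "c = norm (xhat, muhat)"
  define A where "A = (\<lambda>k. \<gamma> k * \<alpha> k)"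
  define \<rho> where "\<rho> = (\<lambda>k. \<bar>\<alpha> k - \<alpha> (Suc k)\<bar> / \<alpha> k / A k)"
  define \<beta> where "\<beta> = (\<lambda>k. 4 * C * (\<gamma> k / \<alpha> k) + 6 * (c * \<rho> k)\<^sup>2)"
  have "eventually (\<lambda>k. \<gamma> k / \<alpha> k < 1 / C) sequentially"
    using order_tendstoD(2)[OF \<gamma>\<alpha>] \<open>C > 0\<close> by simp
  moreover have "eventually (\<lambda>k. A k < 1) sequentially"
    unfolding A_def by (rule order_tendstoD(2)[OF prod]) simp
  ultimately have ev: "eventually (\<lambda>k. k \<ge> 2 \<and> \<gamma> k / \<alpha> k < 1 / C \<and> A k < 1) sequentially"
    using eventually_ge_at_top[of 2] by eventually_elim simp
  have A_pos: "A k > 0" if "k \<ge> 1" for k using \<gamma>[OF that] \<alpha>(1)[OF that] by (simp add: A_def)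
  show ?thesis
  proof (rule recursive_inequality_tendsto_0[where a = "\<lambda>k. A k / 2" and \<beta> = \<beta>])
    show "0 \<le> err k" for k by (simp add: err_def)
    show "eventually (\<lambda>k. err (Suc k) \<le> (1 - A k / 2) * err k + A k / 2 * \<beta> k) sequentially"
      using ev
    proof eventually_elim
      case (elim k)
      then have k: "k \<ge> 1" by simp
      note pos = \<gamma>[OF k] \<alpha>(1)[OF k] A_pos[OF k]
      define E where "E = expectation (\<lambda>\<omega>. (norm (Z (Suc k) \<omega> - saddle.tik (\<alpha> k)))\<^sup>2)"
      define D where "D = norm (saddle.tik (\<alpha> k) - saddle.tik (\<alpha> (Suc k)))"
      have "C * \<gamma> k \<le> \<alpha> k" using elim pos \<open>C > 0\<close> by (simp add: field_simps)
      then have "\<gamma> k * (C * \<gamma> k) \<le> A k" unfolding A_def using pos by (intro mult_left_mono) auto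
      then have small: "C * (\<gamma> k)\<^sup>2 \<le> A k" by (simp add: power2_eq_square mult_ac)
      have err: "0 \<le> err k" by (simp add: err_def)
      have "E \<le> (1 - 2 * A k + C * (\<gamma> k)\<^sup>2) * err k + C * (\<gamma> k)\<^sup>2"
        using C[of k] elim by (simp add: E_def A_def mult.assoc)
      also have "\<dots> \<le> (1 - A k) * err k + C * (\<gamma> k)\<^sup>2"
        using small err by (intro add_mono mult_right_mono) auto
      finally have E: "E \<le> (1 - A k) * err k + C * (\<gamma> k)\<^sup>2" .
      have "(1 + A k / 2) * E \<le> (1 + A k / 2) * ((1 - A k) * err k + C * (\<gamma> k)\<^sup>2)"
        using E pos by (intro mult_left_mono) auto
      also have "\<dots> = (1 + A k / 2) * (1 - A k) * err k + (1 + A k / 2) * (C * (\<gamma> k)\<^sup>2)"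
        by (simp add: distrib_left)
      also have "\<dots> \<le> (1 - A k / 2) * err k + 2 * (C * (\<gamma> k)\<^sup>2)"
      proof (intro add_mono mult_right_mono)
        have "(1 + A k / 2) * (1 - A k) = 1 - A k / 2 - (A k)\<^sup>2 / 2"
          by (simp add: power2_eq_square field_simps)
        then show "(1 + A k / 2) * (1 - A k) \<le> 1 - A k / 2" by simp
      qed (use elim err \<open>C > 0\<close> in auto)
      finally have 1: "(1 + A k / 2) * E \<le> (1 - A k / 2) * err k + 2 * (C * (\<gamma> k)\<^sup>2)" .
      have "\<alpha> k * D \<le> \<bar>\<alpha> k - \<alpha> (Suc k)\<bar> * c"
        unfolding D_def c_def using k by (intro saddle.tik_lipschitz \<alpha>(1)) auto
      then have "D \<le> A k * (c * \<rho> k)" using pos by (simp add: \<rho>_def field_simps)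
      then have "D\<^sup>2 \<le> (A k * (c * \<rho> k))\<^sup>2" by (intro power_mono) (auto simp: D_def)
      then have "(1 + 1 / (A k / 2)) * D\<^sup>2 \<le> (3 / A k) * (A k * (c * \<rho> k))\<^sup>2"
        using pos elim by (intro mult_mono) (auto simp: field_simps)
      also have "\<dots> = 3 * A k * (c * \<rho> k)\<^sup>2" using pos by (simp add: power2_eq_square field_simps)
      finally have 2: "(1 + 1 / (A k / 2)) * D\<^sup>2 \<le> 3 * A k * (c * \<rho> k)\<^sup>2" .
      have "2 * (C * (\<gamma> k)\<^sup>2) = A k / 2 * (4 * C * (\<gamma> k / \<alpha> k))"
        using pos by (simp add: A_def power2_eq_square field_simps)
      then have "A k / 2 * \<beta> k = 2 * (C * (\<gamma> k)\<^sup>2) + 3 * A k * (c * \<rho> k)\<^sup>2"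
        by (simp add: \<beta>_def algebra_simps)
      \<comment> \<open>The weight \<open>A k / 2\<close> spends half of the contraction on the motion of the target.\<close>
      then show ?case
        using err_Suc_le[OF k, of "A k / 2", folded E_def D_def] 1 2 pos(3) by linarith
    qed
    show "eventually (\<lambda>k. 0 \<le> A k / 2 \<and> A k / 2 \<le> 1) sequentially"
      using ev
    proof eventually_elim
      case (elim k)
      then show ?case using A_pos[of k] by simp
    qed
    have "filterlim (\<lambda>n. 1 / 2 * (\<Sum>k<n. \<gamma> k * \<alpha> k)) at_top sequentially"
      by (rule filterlim_tendsto_pos_mult_at_top[OF tendsto_const _ div]) simp
    then show "filterlim (\<lambda>n. \<Sum>k<n. A k / 2) at_top sequentially"
      by (simp add: A_def sum_divide_distrib)
    have "(\<lambda>k. 4 * C * (\<gamma> k / \<alpha> k) + 6 * (c * \<rho> k)\<^sup>2) \<longlonglongrightarrow> 4 * C * 0 + 6 * (c * 0)\<^sup>2"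
      using drift unfolding \<rho>_def A_def by (intro tendsto_intros \<gamma>\<alpha>)
    then show "\<beta> \<longlonglongrightarrow> 0" by (simp add: \<beta>_def)
  qed
qed

lemma mean_square_convergence:
  assumes "(\<lambda>k. \<gamma> k / \<alpha> k) \<longlonglongrightarrow> 0" "(\<lambda>k. \<gamma> k * \<alpha> k) \<longlonglongrightarrow> 0"
    and "(\<lambda>k. \<bar>\<alpha> k - \<alpha> (Suc k)\<bar> / \<alpha> k / (\<gamma> k * \<alpha> k)) \<longlonglongrightarrow> 0"
    and "filterlim (\<lambda>n. \<Sum>k<n. \<gamma> k * \<alpha> k) at_top sequentially"
    and \<alpha>0: "\<alpha> \<longlonglongrightarrow> 0"
  shows "(\<lambda>k. expectation (\<lambda>\<omega>. (norm (Z k \<omega> - (xhat, muhat)))\<^sup>2)) \<longlonglongrightarrow> 0"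
proof -
  define zh where "zh = (xhat, muhat)"
  have "(\<lambda>k. saddle.tik (\<alpha> (Suc k))) \<longlonglongrightarrow> zh"
    unfolding zh_def by (rule saddle.tik_tendsto) (auto intro: \<alpha>(1) LIMSEQ_Suc[OF \<alpha>0])
  then have t: "(\<lambda>k. saddle.tik (\<alpha> k)) \<longlonglongrightarrow> zh" by (rule LIMSEQ_imp_Suc)
  have "(\<lambda>k. 2 * err k + 2 * (norm (saddle.tik (\<alpha> k) - zh))\<^sup>2) \<longlonglongrightarrow> 2 * 0 + 2 * (norm (zh - zh))\<^sup>2"
    by (intro tendsto_intros err_tendsto_0 t) fact+
  then have lim: "(\<lambda>k. 2 * err k + 2 * (norm (saddle.tik (\<alpha> k) - zh))\<^sup>2) \<longlonglongrightarrow> 0" by simp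
  have "eventually (\<lambda>k. expectation (\<lambda>\<omega>. (norm (Z k \<omega> - zh))\<^sup>2)
      \<le> 2 * err k + 2 * (norm (saddle.tik (\<alpha> k) - zh))\<^sup>2) sequentially"
    using eventually_ge_at_top[of 1]
  proof eventually_elim
    case (elim k)
    note int = integrable_norm_Z_diff[OF elim]
    have "expectation (\<lambda>\<omega>. (norm (Z k \<omega> - zh))\<^sup>2)
        \<le> expectation (\<lambda>\<omega>. 2 * (norm (Z k \<omega> - saddle.tik (\<alpha> k)))\<^sup>2 + 2 * (norm (saddle.tik (\<alpha> k) - zh))\<^sup>2)"
    proof (rule integral_mono[OF int])
      show "integrable P (\<lambda>\<omega>. 2 * (norm (Z k \<omega> - saddle.tik (\<alpha> k)))\<^sup>2 + 2 * (norm (saddle.tik (\<alpha> k) - zh))\<^sup>2)"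
        using int by simp
      show "(norm (Z k \<omega> - zh))\<^sup>2
          \<le> 2 * (norm (Z k \<omega> - saddle.tik (\<alpha> k)))\<^sup>2 + 2 * (norm (saddle.tik (\<alpha> k) - zh))\<^sup>2" for \<omega>
        using power2_norm_add_le[of "Z k \<omega> - saddle.tik (\<alpha> k)" "saddle.tik (\<alpha> k) - zh"] by simp
    qed
    also have "\<dots> = 2 * err k + 2 * (norm (saddle.tik (\<alpha> k) - zh))\<^sup>2"
      using int by (simp add: err_def prob_space)
    finally show ?case .
  qed
  then show ?thesis
    unfolding zh_def[symmetric] by (intro tendsto_sandwich[OF _ _ tendsto_const lim]) auto
qed

lemma
  assumes "k \<ge> 1"
  shows integrable_norm_fst: "integrable P (\<lambda>\<omega>. (norm (fst (Z k \<omega>) - xhat))\<^sup>2)"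
    and integrable_norm_snd: "integrable P (\<lambda>\<omega>. (norm (snd (Z k \<omega>) - muhat))\<^sup>2)"
    and expectation_norm_fst_le: "expectation (\<lambda>\<omega>. (norm (fst (Z k \<omega>) - xhat))\<^sup>2)
      \<le> expectation (\<lambda>\<omega>. (norm (Z k \<omega> - (xhat, muhat)))\<^sup>2)"
    and expectation_norm_snd_le: "expectation (\<lambda>\<omega>. (norm (snd (Z k \<omega>) - muhat))\<^sup>2)
      \<le> expectation (\<lambda>\<omega>. (norm (Z k \<omega> - (xhat, muhat)))\<^sup>2)"
proof -
  note int = integrable_norm_Z_diff[OF assms, of "(xhat, muhat)"]
  have m: "(\<lambda>\<omega>. fst (Z k \<omega>)) \<in> borel_measurable P" "(\<lambda>\<omega>. snd (Z k \<omega>)) \<in> borel_measurable P"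
    by (auto intro!: borel_measurable_continuous_on[OF _ borel_measurable_Z[OF assms]] continuous_intros)
  have le: "(norm (fst (Z k \<omega>) - xhat))\<^sup>2 \<le> (norm (Z k \<omega> - (xhat, muhat)))\<^sup>2"
    "(norm (snd (Z k \<omega>) - muhat))\<^sup>2 \<le> (norm (Z k \<omega> - (xhat, muhat)))\<^sup>2" for \<omega>
    using norm_fst_le_norm[of "Z k \<omega> - (xhat, muhat)"] norm_snd_le_norm[of "Z k \<omega> - (xhat, muhat)"]
    by (auto intro: power_mono)
  show i1: "integrable P (\<lambda>\<omega>. (norm (fst (Z k \<omega>) - xhat))\<^sup>2)"
    by (rule Bochner_Integration.integrable_bound[OF int]) (use m le in auto)
  show i2: "integrable P (\<lambda>\<omega>. (norm (snd (Z k \<omega>) - muhat))\<^sup>2)"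
    by (rule Bochner_Integration.integrable_bound[OF int]) (use m le in auto)
  show "expectation (\<lambda>\<omega>. (norm (fst (Z k \<omega>) - xhat))\<^sup>2)
      \<le> expectation (\<lambda>\<omega>. (norm (Z k \<omega> - (xhat, muhat)))\<^sup>2)" by (rule integral_mono[OF i1 int le(1)])
  show "expectation (\<lambda>\<omega>. (norm (snd (Z k \<omega>) - muhat))\<^sup>2)
      \<le> expectation (\<lambda>\<omega>. (norm (Z k \<omega> - (xhat, muhat)))\<^sup>2)" by (rule integral_mono[OF i2 int le(2)])
qed

end

section \<open>Polynomial step sizes\<close>

context
  fixes \<gamma>bar \<alpha>bar c1 c2 :: real
  assumes pos: "\<gamma>bar > 0" "\<alpha>bar > 0" and c: "0 < c2" "c2 < c1" "c1 + c2 < 1"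
begin

private definition \<gamma> :: "nat \<Rightarrow> real" where "\<gamma> k = \<gamma>bar * real k powr (- c1)"
private definition \<alpha> :: "nat \<Rightarrow> real" where "\<alpha> k = \<alpha>bar * real k powr (- c2)"

private lemma powr_lim: "s < 0 \<Longrightarrow> (\<lambda>k. real k powr s) \<longlonglongrightarrow> 0"
  by (rule tendsto_neg_powr) (simp_all add: filterlim_real_sequentially)

private lemma prod: "\<gamma> k * \<alpha> k = \<gamma>bar * \<alpha>bar * real k powr (- c1 - c2)"
  by (simp add: \<gamma>_def \<alpha>_def powr_diff powr_minus field_simps)

private lemma power_steps_ratio: "(\<lambda>k. \<gamma> k / \<alpha> k) \<longlonglongrightarrow> 0"
proof -
  have "(\<lambda>k. \<gamma>bar / \<alpha>bar * real k powr (c2 - c1)) \<longlonglongrightarrow> \<gamma>bar / \<alpha>bar * 0"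
    using c by (intro tendsto_intros powr_lim) simp
  moreover have "\<gamma> k / \<alpha> k = \<gamma>bar / \<alpha>bar * real k powr (c2 - c1)" for k
    by (simp add: \<gamma>_def \<alpha>_def powr_diff powr_minus field_simps)
  ultimately show ?thesis by simp
qed

private lemma power_steps_prod: "(\<lambda>k. \<gamma> k * \<alpha> k) \<longlonglongrightarrow> 0"
proof -
  have "(\<lambda>k. \<gamma>bar * \<alpha>bar * real k powr (- c1 - c2)) \<longlonglongrightarrow> \<gamma>bar * \<alpha>bar * 0"
    using c by (intro tendsto_intros powr_lim) simp
  then show ?thesis by (simp add: prod)
qed

private lemma power_steps_regularization: "\<alpha> \<longlonglongrightarrow> 0"
proof -
  have "(\<lambda>k. \<alpha>bar * real k powr (- c2)) \<longlonglongrightarrow> \<alpha>bar * 0"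
    using c by (intro tendsto_intros powr_lim) simp
  then show ?thesis by (simp add: \<alpha>_def[abs_def])
qed

text \<open>Since \<open>c2 < 1\<close>, the quotient \<open>q = k / (k + 1)\<close> satisfies \<open>q \<le> q powr c2\<close>, so the relative change of
  the regularization in step \<open>k\<close> is at most \<open>1 / k\<close>.\<close>

private lemma power_steps_drift: "(\<lambda>k. \<bar>\<alpha> k - \<alpha> (Suc k)\<bar> / \<alpha> k / (\<gamma> k * \<alpha> k)) \<longlonglongrightarrow> 0"
proof -
  have "(\<lambda>k. real k powr (c1 + c2 - 1) / (\<gamma>bar * \<alpha>bar)) \<longlonglongrightarrow> 0 / (\<gamma>bar * \<alpha>bar)"
    using c pos by (intro tendsto_intros powr_lim) auto
  then have lim: "(\<lambda>k. real k powr (c1 + c2 - 1) / (\<gamma>bar * \<alpha>bar)) \<longlonglongrightarrow> 0" by simp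
  have ev: "eventually (\<lambda>k. \<bar>\<alpha> k - \<alpha> (Suc k)\<bar> / \<alpha> k / (\<gamma> k * \<alpha> k)
      \<le> real k powr (c1 + c2 - 1) / (\<gamma>bar * \<alpha>bar) \<and> 0 \<le> \<bar>\<alpha> k - \<alpha> (Suc k)\<bar> / \<alpha> k / (\<gamma> k * \<alpha> k)) sequentially"
    using eventually_ge_at_top[of 1]
  proof eventually_elim
    case (elim k)
    define q where "q = real k / real (Suc k)"
    have k: "0 < real k" using elim by simp
    have \<alpha>k: "0 < \<alpha> k" using k pos by (simp add: \<alpha>_def)
    have \<gamma>\<alpha>: "0 < \<gamma> k * \<alpha> k" using k pos by (simp add: prod)
    have q: "0 \<le> q" "q \<le> 1" by (auto simp: q_def)
    have \<alpha>S: "\<alpha> (Suc k) = \<alpha> k * q powr c2"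
      using k by (simp add: \<alpha>_def q_def powr_divide powr_minus field_simps)
    have "q = q powr 1" using q by simp
    also have "\<dots> \<le> q powr c2" using c q by (intro powr_mono') auto
    finally have "q \<le> q powr c2" .
    moreover have "q powr c2 \<le> 1" using q c by (intro powr_le1) auto
    moreover have "1 - q \<le> 1 / real k" using k by (simp add: q_def field_simps)
    ultimately have "\<bar>1 - q powr c2\<bar> \<le> 1 / real k" by simp
    moreover have "\<alpha> k - \<alpha> (Suc k) = \<alpha> k * (1 - q powr c2)" by (simp add: \<alpha>S algebra_simps)
    ultimately have "\<bar>\<alpha> k - \<alpha> (Suc k)\<bar> / \<alpha> k \<le> 1 / real k"
      using \<alpha>k by (simp add: abs_mult)
    then have "\<bar>\<alpha> k - \<alpha> (Suc k)\<bar> / \<alpha> k / (\<gamma> k * \<alpha> k) \<le> 1 / real k / (\<gamma> k * \<alpha> k)"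
      using \<gamma>\<alpha> by (intro divide_right_mono) auto
    also have "\<dots> = real k powr (c1 + c2 - 1) / (\<gamma>bar * \<alpha>bar)"
      using k pos unfolding prod by (simp add: powr_diff powr_minus powr_add field_simps)
    finally show ?case using \<alpha>k \<gamma>\<alpha> by simp
  qed
  show ?thesis
    by (rule tendsto_sandwich[OF _ _ tendsto_const lim]) (use ev in \<open>auto elim: eventually_mono\<close>)
qed

private lemma power_steps_divergent: "filterlim (\<lambda>n. \<Sum>k<n. \<gamma> k * \<alpha> k) at_top sequentially"
proof -
  define A where "A = (\<lambda>k. \<gamma> k * \<alpha> k)"
  have nn: "0 \<le> A k" for k using pos by (simp add: A_def prod)
  have "\<not> summable (\<lambda>k. real k powr (- c1 - c2))" using c by (simp add: summable_real_powr_iff)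
  then have "\<not> summable A"
    using pos by (simp add: A_def prod summable_cmult_iff)
  then have unb: "\<exists>n. B < (\<Sum>k<n. A k)" for B
    using summableI_nonneg_bounded[of A B] nn by (meson not_less)
  have "filterlim (\<lambda>n. \<Sum>k<n. A k) at_top sequentially"
    unfolding filterlim_at_top
  proof
    fix B
    obtain n where "B < (\<Sum>k<n. A k)" using unb by blast
    moreover have "(\<Sum>k<n. A k) \<le> (\<Sum>k<m. A k)" if "n \<le> m" for m
      using that nn by (intro sum_mono2) auto
    ultimately show "eventually (\<lambda>m. B \<le> (\<Sum>k<m. A k)) sequentially"
      unfolding eventually_sequentially by (intro exI[of _ n]) force
  qed
  then show ?thesis by (simp add: A_def)
qed

lemmas power_steps = power_steps_ratio[unfolded \<gamma>_def \<alpha>_def] power_steps_prod[unfolded \<gamma>_def \<alpha>_def]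
  power_steps_drift[unfolded \<gamma>_def \<alpha>_def] power_steps_divergent[unfolded \<gamma>_def \<alpha>_def]
  power_steps_regularization[unfolded \<alpha>_def[abs_def]]

end

section \<open>Privacy and convergence\<close>

lemma (in prob_space) indep_vars_inj:
  assumes ind: "indep_vars (\<lambda>_. N) X UNIV" and h: "inj h"
  shows "indep_vars (\<lambda>_. N) (\<lambda>k. X (h k)) UNIV"
proof -
  have "indep_vars (\<lambda>k. PiM {h k} (\<lambda>_. N)) (\<lambda>k \<omega>. \<lambda>i\<in>{h k}. X i \<omega>) UNIV"
    by (rule indep_vars_restrict[OF ind]) (use h in \<open>auto simp: disjoint_family_on_def inj_def\<close>)
  then have "indep_vars (\<lambda>_. N) (\<lambda>k \<omega>. (\<lambda>\<nu>. \<nu> (h k)) (\<lambda>i\<in>{h k}. X i \<omega>)) UNIV"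
    by (rule indep_vars_compose2) (rule measurable_component_singleton, simp)
  then show ?thesis by simp
qed

theorem mainTheorem1:
  fixes X :: "(real^'n::finite) set"
    and f :: "'n \<Rightarrow> real \<Rightarrow> real"
    and g :: "real^'n \<Rightarrow> real^'m::finite"
    and xhat :: "real^'n" and muhat :: "real^'m"
    and \<epsilon> \<delta> :: real
    and b :: "'n \<Rightarrow> real"
    and \<sigma> :: "'n \<Rightarrow> real" and \<sigma>g :: real
    and P :: "'w measure"
    and w :: "'n \<Rightarrow> nat \<Rightarrow> 'w \<Rightarrow> real^'m"
    and wg :: "nat \<Rightarrow> 'w \<Rightarrow> real^'m"
  assumes X: "X \<noteq> {}" "compact X" "convex X"
    and f: "\<And>i. convex_on UNIV (f i)" "\<And>i. C2 (f i)"
    and g: "\<And>j. convex_on UNIV (\<lambda>x. g x $ j)" "\<And>j. C2 (\<lambda>x. g x $ j)"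
    and slater: "\<exists>xbar\<in>X. \<forall>j. g xbar $ j < 0"
    and saddle: "is_saddle_point (lagrangian f g) X nonneg_orthant xhat muhat"
    and saddle_unique: "\<And>x \<mu>. is_saddle_point (lagrangian f g) X nonneg_orthant x \<mu> \<Longrightarrow>
      x = xhat \<and> \<mu> = muhat"
    and \<epsilon>: "\<epsilon> > 0"
    and \<delta>: "0 < \<delta>" "\<delta> < 1"
    and b: "\<And>i. 0 \<le> b i"
    and \<sigma>: "\<And>i. \<sigma> i \<ge> kappa \<delta> \<epsilon> * lipschitz_const X (partial_deriv g i) * Max (range b)"
    and \<sigma>g: "\<sigma>g \<ge> kappa \<delta> \<epsilon> * lipschitz_const X g * Max (range b)"
    and P: "prob_space P"
    and w: "\<And>i k. distr P borel (w i k) = gaussian_iso (\<sigma> i)"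
    and wg: "\<And>k. distr P borel (wg k) = gaussian_iso \<sigma>g"
    and indep: "prob_space.indep_vars P (\<lambda>_. borel) (noise_family w wg) UNIV"
  shows
    "((\<forall>i. differentially_private P (input_signals X) (adj b) \<epsilon> \<delta> (mech_grad g w i)) \<and>
      differentially_private P (input_signals X) (adj b) \<epsilon> \<delta> (mech_g g wg)) \<and>
     (\<forall>\<gamma>bar \<alpha>bar c1 c2 x1 \<mu>1 x \<mu>.
        \<gamma>bar > 0 \<and> \<alpha>bar > 0 \<and> 0 < c2 \<and> c2 < c1 \<and> c1 + c2 < 1 \<and> x1 \<in> X \<and>
        private_primal_dual P X f g w wg
          (\<lambda>k. \<gamma>bar * real k powr (- c1)) (\<lambda>k. \<alpha>bar * real k powr (- c2)) x1 \<mu>1 x \<mu>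
        \<longrightarrow>
        (\<forall>k\<ge>1. integrable P (\<lambda>\<omega>. (norm (x k \<omega> - xhat))\<^sup>2) \<and>
                integrable P (\<lambda>\<omega>. (norm (\<mu> k \<omega> - muhat))\<^sup>2)) \<and>
        (\<lambda>k. prob_space.expectation P (\<lambda>\<omega>. (norm (x k \<omega> - xhat))\<^sup>2)) \<longlonglongrightarrow> 0 \<and>
        (\<lambda>k. prob_space.expectation P (\<lambda>\<omega>. (norm (\<mu> k \<omega> - muhat))\<^sup>2)) \<longlonglongrightarrow> 0)"
proof -
  interpret P: prob_space P by (rule P)
  interpret prog: convex_program X f g xhat muhat
    by (rule convex_program.intro) (fact X f g saddle saddle_unique)+
  let ?N = "noise_family w wg"
  have indep_w: "P.indep_vars (\<lambda>_. borel) (w i) UNIV" for i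
    using P.indep_vars_inj[OF indep, of "\<lambda>k. (Some i, k)"] by (simp add: inj_def noise_family_def)
  have indep_wg: "P.indep_vars (\<lambda>_. borel) wg UNIV"
    using P.indep_vars_inj[OF indep, of "\<lambda>k. (None, k)"] by (simp add: inj_def noise_family_def)
  obtain Cg where Cg: "Cg-lipschitz_on X g" using prog.lipschitz_g by blast
  obtain C where C: "\<And>i. (C i)-lipschitz_on X (partial_deriv g i)"
    using prog.lipschitz_partial_deriv_g by metis
  have privacy: "differentially_private P (input_signals X) (adj b) \<epsilon> \<delta> (mech_grad g w i)" for i
    using P.gaussian_differentially_private[OF C indep_w w \<epsilon> \<delta> \<sigma>] unfolding mech_grad_def[abs_def] .
  have privacy_g: "differentially_private P (input_signals X) (adj b) \<epsilon> \<delta> (mech_g g wg)"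
    using P.gaussian_differentially_private[OF Cg indep_wg wg \<epsilon> \<delta> \<sigma>g] unfolding mech_g_def[abs_def] .
  have "0 \<le> Max (range b)" using b by (simp add: Max_ge_iff)
  then have scale: "0 \<le> kappa \<delta> \<epsilon> * lipschitz_const X h * Max (range b)"
    if "D-lipschitz_on X h" for D and h :: "real^'n \<Rightarrow> real^'m"
    using lipschitz_on_nonneg[OF lipschitz_const_attained[OF that]] kappa_pos[OF \<epsilon>, of \<delta>] by simp
  define s where "s = case_option \<sigma>g \<sigma>"
  have s_nonneg: "0 \<le> s \<iota>" for \<iota>
    using order_trans[OF scale[OF Cg] \<sigma>g] order_trans[OF scale[OF C] \<sigma>]
    by (cases \<iota>) (simp_all add: s_def)
  \<comment> \<open>A sum over all sources, as a common bound for their variances.\<close>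
  define V where "V = (\<Sum>\<iota>\<in>UNIV. real CARD('m) * (s \<iota>)\<^sup>2)"
  have rv: "P.random_variable borel (?N \<iota>)" for \<iota>
    using indep unfolding P.indep_vars_def by blast
  have law: "distr P borel (?N \<iota>) = gaussian_iso (s (fst \<iota>))" for \<iota>
    using w wg by (cases \<iota>; cases "fst \<iota>") (auto simp: noise_family_def s_def)
  note moments = P.gaussian_iso_integrable_nth[OF rv law s_nonneg]
    P.gaussian_iso_expectation_nth[OF rv law s_nonneg]
    P.gaussian_iso_integrable_norm[OF rv law s_nonneg]
    P.gaussian_iso_expectation_norm[OF rv law s_nonneg]
  have convergence:
    "(\<forall>k\<ge>1. integrable P (\<lambda>\<omega>. (norm (x k \<omega> - xhat))\<^sup>2) \<and>
        integrable P (\<lambda>\<omega>. (norm (\<mu> k \<omega> - muhat))\<^sup>2)) \<and>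
     (\<lambda>k. P.expectation (\<lambda>\<omega>. (norm (x k \<omega> - xhat))\<^sup>2)) \<longlonglongrightarrow> 0 \<and>
     (\<lambda>k. P.expectation (\<lambda>\<omega>. (norm (\<mu> k \<omega> - muhat))\<^sup>2)) \<longlonglongrightarrow> 0"
    if pos: "\<gamma>bar > 0" "\<alpha>bar > 0" and c: "0 < c2" "c2 < c1" "c1 + c2 < 1" and x1: "x1 \<in> X"
      and run: "private_primal_dual P X f g w wg
          (\<lambda>k. \<gamma>bar * real k powr (- c1)) (\<lambda>k. \<alpha>bar * real k powr (- c2)) x1 \<mu>1 x \<mu>"
    for \<gamma>bar \<alpha>bar c1 c2 x1 \<mu>1 x \<mu>
  proof -
    define \<gamma> where "\<gamma> = (\<lambda>k. \<gamma>bar * real k powr (- c1))"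
    define \<alpha> where "\<alpha> = (\<lambda>k. \<alpha>bar * real k powr (- c2))"
    define Z where "Z = (\<lambda>k \<omega>. (x k \<omega>, \<mu> k \<omega>))"
    have "private_primal_dual P X f g w wg \<gamma> \<alpha> x1 \<mu>1 x \<mu>"
      using run by (simp only: \<gamma>_def \<alpha>_def)
    note run' = this[unfolded private_primal_dual_def]
    have jacobian: "transpose (noisy_jacobian g v y) *v m
        = (\<chi> i. partial_deriv g i y \<bullet> m) + (\<chi> i. v i \<bullet> m)" for v y m
      by (simp add: vec_eq_iff matrix_vector_mult_def transpose_def noisy_jacobian_def
          inner_vec_def distrib_right sum.distrib)
    interpret it: noisy_saddle_iteration X f g xhat muhat P ?N V \<gamma> \<alpha> \<alpha>bar "(x1, \<mu>1)" Z
    proof (intro noisy_saddle_iteration.intro noisy_saddle_iteration_axioms.intro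
        prog.convex_program_axioms P.prob_space_axioms indep moments(1,2,3))
      show "P.expectation (\<lambda>\<omega>. (norm (?N \<iota> \<omega>))\<^sup>2) \<le> V" for \<iota>
        unfolding moments(4) V_def by (rule member_le_sum) auto
      show "0 < \<gamma> k" "0 < \<alpha> k" "\<alpha> k \<le> \<alpha>bar" if "k \<ge> 1" for k
        using that pos c powr_mono[of "- c2" 0 "real k"] by (auto simp: \<gamma>_def \<alpha>_def)
      show "Z 1 \<omega> = (x1, \<mu>1)" if "\<omega> \<in> space P" for \<omega> using run' that by (simp add: Z_def)
      show "fst (x1, \<mu>1) \<in> X" using x1 by simp
      show "Z (Suc k) \<omega> = map_prod (closest_point X) (closest_point nonneg_orthant)
          (Z k \<omega> - \<gamma> k *\<^sub>R (prog.saddle_op (Z k \<omega>) + \<alpha> k *\<^sub>R Z k \<omega>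
            + ((\<chi> i. ?N (Some i, k) \<omega> \<bullet> snd (Z k \<omega>)), - ?N (None, k) \<omega>)))"
        if "\<omega> \<in> space P" "k \<ge> 1" for \<omega> k
      proof -
        have "x (k + 1) \<omega> = closest_point X (x k \<omega> - \<gamma> k *\<^sub>R (grad (total_cost f) (x k \<omega>)
                + ((\<chi> i. partial_deriv g i (x k \<omega>) \<bullet> \<mu> k \<omega>) + (\<chi> i. w i k \<omega> \<bullet> \<mu> k \<omega>))
                + \<alpha> k *\<^sub>R x k \<omega>))"
          and "\<mu> (k + 1) \<omega> = closest_point nonneg_orthant
             (\<mu> k \<omega> + \<gamma> k *\<^sub>R (g (x k \<omega>) + wg k \<omega> - \<alpha> k *\<^sub>R \<mu> k \<omega>))"
          using run' that unfolding jacobian by blast+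
        then show ?thesis
          by (simp add: Z_def prog.saddle_op_def prog.primal_grad_def noise_family_def algebra_simps)
      qed
    qed
    have lim: "(\<lambda>k. P.expectation (\<lambda>\<omega>. (norm (Z k \<omega> - (xhat, muhat)))\<^sup>2)) \<longlonglongrightarrow> 0"
      by (rule it.mean_square_convergence)
        (use power_steps[OF pos c] in \<open>simp_all add: \<gamma>_def \<alpha>_def\<close>)
    have "(\<lambda>k. P.expectation (\<lambda>\<omega>. (norm (fst (Z k \<omega>) - xhat))\<^sup>2)) \<longlonglongrightarrow> 0"
      by (rule tendsto_sandwich[OF _ _ tendsto_const lim])
        (auto intro: eventually_mono[OF eventually_ge_at_top[of 1]] it.expectation_norm_fst_le)
    moreover have "(\<lambda>k. P.expectation (\<lambda>\<omega>. (norm (snd (Z k \<omega>) - muhat))\<^sup>2)) \<longlonglongrightarrow> 0"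
      by (rule tendsto_sandwich[OF _ _ tendsto_const lim])
        (auto intro: eventually_mono[OF eventually_ge_at_top[of 1]] it.expectation_norm_snd_le)
    ultimately show ?thesis
      using it.integrable_norm_fst it.integrable_norm_snd by (simp add: Z_def)
  qed
  show ?thesis using privacy privacy_g convergence by blast
qed

end
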